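(* For $n\ge 1$ and $k\ge 1$, the number of permutations of genus $1$ in $S_n$ with $k$ cycles is $$p_*(n,k)=\frac16\binom{n+1}{2}\binom{n-1}{k+1}\binom{n-1}{k-1}.$$ More precisely, for $j=0,1,2$, the number $p_j(n,k)$ of permutations of genus $1$ in $S_n$ with exactly $j$ back points and $k$ cycles is $$p_0(n,k)=\frac16\binom{n}{2}\binom{n-2}{k}\binom{n-2}{k-2},\qquad p_2(n,k)=\frac16\binom{n}{2}\binom{n-2}{k+1}\binom{n-2}{k-1},$$ $$p_1(n,k)=\frac13\binom{n}{2}\binom{n-2}{k}\binom{n-2}{k-1}.$$ In particular $p_0(n,k)$ is the number of partitions of $\{1,\dots,n\}$ of genus one with $k$ parts.
   Context: For $n\ge 1$ let $\zeta_n\in S_n$ be the cyclic permutation $\zeta_n(i)=i+1$ for $i<n$, $\zeta_n(n)=1$. Permutations are composed right to left, and $z(\pi)$ denotes the number of cycles of $\pi$ (fixed points included). The genus $g(\alpha)$ of $\alpha\in S_n$ is the non-negative integer defined by $n+1-2g(\alpha)=z(\alpha)+z(\alpha^{-1}\zeta_n)$. An element $i$ is a back point of $\alpha$ if $\alpha(i)<i$ and $\alpha(i)$ is not the smallest element of its cycle. A partition of $\{1,\dots,n\}$ is identified with the permutation whose cycles are its blocks written in increasing order; these are exactly the permutations with no back points, and the genus of a partition is the genus of this permutation. Binomial coefficients $\binom{m}{r}$ are $0$ when $r<0$ or $r>m$. *)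

theory Defs
  imports Complex_Main "HOL-Combinatorics.Cycles" "HOL-Combinatorics.Orbits" "HOL-Library.Disjoint_Sets"
begin

definition zeta :: "nat \<Rightarrow> nat \<Rightarrow> nat" where
  "zeta n i = (if 1 \<le> i \<and> i < n then i + 1 else if i = n then 1 else i)"

(* Fixed points count as cycles: for a fixed point i the orbit is {i}. *)
definition num_cycles :: "nat \<Rightarrow> (nat \<Rightarrow> nat) \<Rightarrow> nat" where
  "num_cycles n \<pi> = card (orbit \<pi> ` {1..n})"

(* The defining equation n + 1 - 2 g = z(\<alpha>) + z(\<alpha>^{-1} \<zeta>_n) of the genus, which
   determines the natural number g; stated in the integers to avoid truncated subtraction. *)
definition has_genus :: "nat \<Rightarrow> (nat \<Rightarrow> nat) \<Rightarrow> nat \<Rightarrow> bool" where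
  "has_genus n \<alpha> g \<longleftrightarrow>
     int n + 1 - 2 * int g = int (num_cycles n \<alpha>) + int (num_cycles n (inv \<alpha> \<circ> zeta n))"

definition back_points :: "nat \<Rightarrow> (nat \<Rightarrow> nat) \<Rightarrow> nat set" where
  "back_points n \<alpha> = {i \<in> {1..n}. \<alpha> i < i \<and> \<alpha> i \<noteq> Min (orbit \<alpha> i)}"

(* The permutation whose cycles are the blocks of P, each written in increasing order. *)
definition partition_perm :: "nat set set \<Rightarrow> nat \<Rightarrow> nat" where
  "partition_perm P i =
     (if i \<in> \<Union>P then cycle_of_list (sorted_list_of_set (THE B. B \<in> P \<and> i \<in> B)) i else i)"

definition genus1_perms :: "nat \<Rightarrow> nat \<Rightarrow> (nat \<Rightarrow> nat) set" where
  "genus1_perms n k = {\<alpha>. \<alpha> permutes {1..n} \<and> has_genus n \<alpha> 1 \<and> num_cycles n \<alpha> = k}"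

definition p_star :: "nat \<Rightarrow> nat \<Rightarrow> nat" where
  "p_star n k = card (genus1_perms n k)"

definition p_back :: "nat \<Rightarrow> nat \<Rightarrow> nat \<Rightarrow> nat" where
  "p_back j n k = card {\<alpha> \<in> genus1_perms n k. card (back_points n \<alpha>) = j}"

definition genus1_partitions :: "nat \<Rightarrow> nat \<Rightarrow> nat set set set" where
  "genus1_partitions n k =
     {P. partition_on {1..n} P \<and> has_genus n (partition_perm P) 1 \<and> card P = k}"

(* Integer arguments, so that e.g. (n - 2 over k - 2) is 0, not 1, when k = 1. *)
definition ibinom :: "int \<Rightarrow> int \<Rightarrow> real" where
  "ibinom m r = (if r < 0 \<or> r > m then 0 else real (nat m choose nat r))"

end

theory Submission
  imports Defs
begin

text \<open>
  Write \<open>\<beta> = \<alpha>\<inverse> \<circ> \<zeta>\<close> for the dual of \<open>\<alpha>\<close> and call the cycles of \<open>\<beta>\<close> faces. Every permutation of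
  \<open>{1..n+1}\<close> arises from one of \<open>{1..n}\<close> by inserting \<open>n+1\<close> as a fixed point or after some \<open>i\<close> in its
  cycle. On the dual side this extends the face of \<open>n\<close> by \<open>n+1\<close> and then multiplies by the
  transposition of \<open>i\<close> and \<open>n+1\<close>: the genus is kept, and the face of \<open>n+1\<close> cut, if \<open>i\<close> lies in the
  face of \<open>n\<close>; otherwise two faces are merged and the genus grows by one. With the size of the face of
  the largest point as a catalytic variable this gives linear recursions whose solutions are explicit
  products of binomial coefficients and a cubic polynomial.

  The number of back points is the number of weak descents minus the number of cycles. Weak descents
  of \<open>\<alpha>\<close> and \<open>\<beta>\<close> add up to \<open>n + 1\<close>, so the back points of \<open>\<alpha>\<close> and \<open>\<beta>\<close> add up to twice the genus.
  Hence in genus one duality exchanges no back point with two, and it is enough to count all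
  permutations and those without back points; the latter obey the same recursion if only weak descents
  in the face of the largest point are counted.
\<close>

section \<open>Orbits under multiplication by a transposition\<close>

text \<open>A merge is charged to a permutation of genus one less, so genus one needs only one thing
  from genus zero: how often the last face and another face have given sizes. This joint count,
  \<open>pair_count\<close>, has its own recursion and a product formula in which the second size
  \<open>l\<close> enters only through \<open>n - t - l\<close>. Summing over the merged face
  therefore gives a cubic in \<open>t\<close>, the source term behind the cubic factor in genus one.
  The same joint count serves permutations without back points: genus zero permutations have none,
  and there the weak descents are all points of the last face and all but one point of every other
  face. On the merge side the two cases differ only by a parameter \<open>e\<close>.

  The closed forms are verified, not derived. Differencing in \<open>t\<close> removes the tail sum
  over \<open>m \<ge> t\<close>, neighbouring binomials are written as multiples of one number, and
  what remains is a polynomial multiple of one linear relation between composition numbers. The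
  total over all \<open>t\<close> need not be summed: it is the value at \<open>n + 1\<close> and
  \<open>t = 1\<close>. The count for exactly one back point follows by subtraction.\<close>

lemma orbit_eq_iff:
  assumes "permutation p"
  shows "orbit p x = orbit p y \<longleftrightarrow> x \<in> orbit p y"
  using assms
  by (metis orbit_swap orbit_trans permutation_self_in_orbit subsetI subset_antisym)

lemma orbit_eq_or_disjoint:
  assumes "permutation p"
  shows "orbit p x = orbit p y \<or> orbit p x \<inter> orbit p y = {}"
  using assms by (metis disjoint_iff orbit_eq_iff)

text \<open>A merged cycle is not among the old ones. This makes the number of orbits drop by
  exactly one in a merge.\<close>

lemma union_orbits_notin:
  assumes p: "permutation p" and ab: "a \<notin> orbit p b"
  shows "orbit p a \<union> orbit p b \<notin> orbit p ` S"
proof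
  assume "orbit p a \<union> orbit p b \<in> orbit p ` S"
  then obtain x where x: "orbit p a \<union> orbit p b = orbit p x" by auto
  have "a \<in> orbit p x" "b \<in> orbit p x"
    unfolding x[symmetric] using permutation_self_in_orbit[OF p] by auto
  then have "orbit p a = orbit p x" "orbit p b = orbit p x"
    using orbit_eq_iff[OF p] by blast+
  then show False
    using ab permutation_self_in_orbit[OF p, of a] by simp
qed

text \<open>Until the path of \<open>x\<close> first meets \<open>a\<close> or \<open>b\<close> the
  transposition changes nothing, and at that first meeting it swaps the endpoint. Merges and cuts
  are both read off from this.\<close>

lemma funpow_transpose_comp:
  fixes p :: "'a \<Rightarrow> 'a"
  assumes "\<And>j. 0 < j \<Longrightarrow> j < t \<Longrightarrow> (p ^^ j) x \<noteq> a \<and> (p ^^ j) x \<noteq> b"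
  shows "j < t \<Longrightarrow> ((transpose a b \<circ> p) ^^ j) x = (p ^^ j) x"
    and "0 < t \<Longrightarrow> ((transpose a b \<circ> p) ^^ t) x = transpose a b ((p ^^ t) x)"
proof -
  show *: "((transpose a b \<circ> p) ^^ j) x = (p ^^ j) x" if "j < t" for j
    using that
  proof (induction j)
    case (Suc j)
    then show ?case
      using assms[of "Suc j"] by simp
  qed simp
  assume "0 < t"
  then obtain u where "t = Suc u" by (cases t) auto
  then show "((transpose a b \<circ> p) ^^ t) x = transpose a b ((p ^^ t) x)"
    using *[of u] by simp
qed

lemma orbit_transpose_merge:
  assumes p: "permutation p" and ab: "a \<notin> orbit p b"
  shows "orbit (transpose a b \<circ> p) a = orbit p a \<union> orbit p b"
proof -
  define q where "q = transpose a b \<circ> p"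
  define A where "A = least_power p a"
  define B where "B = least_power p b"
  have A: "0 < A" "(p ^^ A) a = a" and B: "0 < B" "(p ^^ B) b = b"
    using least_power_of_permutation[OF p] by (auto simp: A_def B_def)
  have orbA: "orbit p a = {(p ^^ m) a | m. m < A}"
    using A(2,1) by (rule orbit_altdef_bounded)
  have orbB: "orbit p b = {(p ^^ m) b | m. m < B}"
    using B(2,1) by (rule orbit_altdef_bounded)
  have ba: "b \<notin> orbit p a"
    using ab p by (metis orbit_eq_iff)
  have a_chain: "(p ^^ j) a \<noteq> a \<and> (p ^^ j) a \<noteq> b" if "0 < j" "j < A" for j
    using that ba orbA least_power_le[of j p a] by (auto simp: A_def)
  have b_chain: "(p ^^ j) b \<noteq> a \<and> (p ^^ j) b \<noteq> b" if "0 < j" "j < B" for j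
    using that ab orbB least_power_le[of j p b] by (auto simp: B_def)
  have qa: "(q ^^ j) a = (p ^^ j) a" if "j < A" for j
    unfolding q_def using funpow_transpose_comp(1)[OF a_chain that] .
  have qb: "(q ^^ j) b = (p ^^ j) b" if "j < B" for j
    unfolding q_def using funpow_transpose_comp(1)[OF b_chain that] .
  \<comment> \<open>Under \<open>p\<close> the walk from \<open>a\<close> closes at time
    \<open>A\<close>; now it is diverted to \<open>b\<close> there, and the walk from
    \<open>b\<close> is diverted to \<open>a\<close> at time \<open>B\<close>. So the new cycle
    closes after \<open>B + A\<close> steps.\<close>
  have qA: "(q ^^ A) a = b"
    using funpow_transpose_comp(2)[OF a_chain A(1)] A by (simp add: q_def)
  have qB: "(q ^^ B) b = a"
    using funpow_transpose_comp(2)[OF b_chain B(1)] B by (simp add: q_def)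
  have qAj: "(q ^^ (j + A)) a = (q ^^ j) b" for j
    by (simp add: funpow_add qA)
  have "orbit q a = {(q ^^ m) a | m. m < B + A}"
    by (rule orbit_altdef_bounded) (use A B in \<open>simp_all add: qAj qB\<close>)
  also have "\<dots> = orbit p a \<union> orbit p b"
  proof (intro equalityI subsetI)
    fix x assume "x \<in> {(q ^^ m) a | m. m < B + A}"
    then obtain m where m: "x = (q ^^ m) a" "m < B + A" by blast
    show "x \<in> orbit p a \<union> orbit p b"
    proof (cases "m < A")
      case True
      then show ?thesis using m qa orbA by auto
    next
      case False
      then have "x = (p ^^ (m - A)) b"
        using m qAj[of "m - A"] qb[of "m - A"] by simp
      then show ?thesis using False m orbB by auto
    qed
  next
    fix x assume "x \<in> orbit p a \<union> orbit p b"
    then consider m where "x = (p ^^ m) a" "m < A" | m where "x = (p ^^ m) b" "m < B"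
      using orbA orbB by auto
    then show "x \<in> {(q ^^ m) a | m. m < B + A}"
    proof cases
      case 1
      then show ?thesis using qa[OF 1(2)] by (intro CollectI exI[of _ m]) simp
    next
      case 2
      then have "x = (q ^^ (m + A)) a" using qAj qb by simp
      then show ?thesis using 2 by auto
    qed
  qed
  finally show ?thesis unfolding q_def .
qed

text \<open>If \<open>b\<close> first appears \<open>t\<close> steps after \<open>a\<close>, the
  step into \<open>b\<close> is redirected to \<open>a\<close>, and the cycle closes early on the
  points strictly before \<open>b\<close>.\<close>

lemma orbit_transpose_cut:
  assumes p: "permutation p" and "0 < t" "(p ^^ t) a = b"
    and "\<And>j. 0 < j \<Longrightarrow> j < t \<Longrightarrow> (p ^^ j) a \<noteq> a \<and> (p ^^ j) a \<noteq> b"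
  shows "orbit (transpose a b \<circ> p) a = (\<lambda>j. (p ^^ j) a) ` {..<t}"
proof -
  have "((transpose a b \<circ> p) ^^ t) a = a"
    using funpow_transpose_comp(2)[OF assms(4) assms(2)] assms(3) by simp
  then have "orbit (transpose a b \<circ> p) a = {((transpose a b \<circ> p) ^^ m) a | m. m < t}"
    using assms(2) by (rule orbit_altdef_bounded)
  also have "\<dots> = (\<lambda>j. (p ^^ j) a) ` {..<t}"
    using funpow_transpose_comp(1)[OF assms(4)] by force
  finally show ?thesis .
qed

lemma orbit_transpose_other:
  assumes p: "permutation p" and x: "x \<notin> orbit p a" "x \<notin> orbit p b"
  shows "orbit (transpose a b \<circ> p) x = orbit p x"
proof (rule orbit_cong)
  show "x \<in> orbit p x" using p by (rule permutation_self_in_orbit)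
  fix s assume s: "s \<in> orbit p x"
  then have "p s \<in> orbit p x" by (rule orbit.step)
  then have "p s \<noteq> a" "p s \<noteq> b"
    using x p by (metis orbit_eq_iff permutation_self_in_orbit)+
  then show "(transpose a b \<circ> p) s = p s" by simp
qed

lemma permutation_transpose_comp:
  "permutation p \<Longrightarrow> permutation (transpose a b \<circ> p)"
  by (simp add: permutation_compose permutation_swap_id)

lemma orbits_transpose_merge:
  assumes p: "permutation p" and ab: "a \<notin> orbit p b" and S: "a \<in> S" "b \<in> S"
  shows "orbit (transpose a b \<circ> p) ` S
    = insert (orbit p a \<union> orbit p b) (orbit p ` S - {orbit p a, orbit p b})" (is "orbit ?q ` S = ?R")
proof -
  have q: "permutation ?q" using p by (rule permutation_transpose_comp)
  have a: "orbit ?q a = orbit p a \<union> orbit p b"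
    using p ab by (rule orbit_transpose_merge)
  have in1: "orbit ?q x = orbit p a \<union> orbit p b" if "x \<in> orbit p a \<union> orbit p b" for x
    using that a orbit_eq_iff[OF q] by metis
  have out: "orbit ?q x = orbit p x \<and> orbit p x \<noteq> orbit p a \<and> orbit p x \<noteq> orbit p b"
    if "x \<notin> orbit p a \<union> orbit p b" for x
    using that orbit_transpose_other[OF p] orbit_eq_iff[OF p] by auto
  show ?thesis
  proof (intro equalityI subsetI)
    fix X assume "X \<in> orbit ?q ` S"
    then obtain x where x: "x \<in> S" "X = orbit ?q x" by auto
    show "X \<in> ?R"
    proof (cases "x \<in> orbit p a \<union> orbit p b")
      case True
      then show ?thesis using in1 x by simp
    next
      case False
      then show ?thesis using out[OF False] x by simp
    qed
  next
    fix X assume "X \<in> ?R"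
    then consider "X = orbit ?q a" | x where "x \<in> S" "X = orbit p x" "X \<noteq> orbit p a" "X \<noteq> orbit p b"
      using a by auto
    then show "X \<in> orbit ?q ` S"
    proof cases
      case 2
      then have "x \<notin> orbit p a \<union> orbit p b" using orbit_eq_iff[OF p] by auto
      then have "X = orbit ?q x" using out 2 by simp
      then show ?thesis using 2 by simp
    qed (use S in auto)
  qed
qed

lemma card_orbits_transpose_merge:
  assumes p: "permutation p" and ab: "a \<notin> orbit p b" and S: "a \<in> S" "b \<in> S" "finite S"
  shows "Suc (card (orbit (transpose a b \<circ> p) ` S)) = card (orbit p ` S)"
proof -
  let ?O = "orbit p ` S"
  have ne: "orbit p a \<noteq> orbit p b" using ab p by (metis permutation_self_in_orbit)
  have new: "orbit p a \<union> orbit p b \<notin> ?O"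
    using p by (rule union_orbits_notin) (rule ab)
  have "card (?O - {orbit p a, orbit p b}) = card ?O - 2"
    using S ne by (subst card_Diff_subset) auto
  moreover have "2 \<le> card ?O"
    using card_mono[of ?O "{orbit p a, orbit p b}"] S ne by simp
  ultimately show ?thesis
    using new S(3) by (simp add: orbits_transpose_merge[OF p ab S(1,2)])
qed

text \<open>The cut is the merge read backwards: multiplying by the transposition twice gives back \<open>p\<close>.\<close>

lemma
  assumes p: "permutation p" and ab: "b \<notin> orbit (transpose a b \<circ> p) a" and S: "a \<in> S" "b \<in> S"
  shows orbits_transpose_cut: "orbit (transpose a b \<circ> p) ` S
      = insert (orbit (transpose a b \<circ> p) a)
          (insert (orbit p a - orbit (transpose a b \<circ> p) a) (orbit p ` S - {orbit p a}))"
    and card_orbits_transpose_cut: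
      "finite S \<Longrightarrow> card (orbit (transpose a b \<circ> p) ` S) = Suc (card (orbit p ` S))"
proof -
  define q where "q = transpose a b \<circ> p"
  have q: "permutation q" unfolding q_def using p by (rule permutation_transpose_comp)
  have pq: "transpose a b \<circ> q = p" by (simp add: q_def o_assoc)
  have ab': "a \<notin> orbit q b" using ab q unfolding q_def[symmetric] by (metis orbit_eq_iff)
  have orb: "orbit p a = orbit q a \<union> orbit q b"
    using orbit_transpose_merge[OF q ab'] pq by simp
  have disj: "orbit q a \<inter> orbit q b = {}"
    using orbit_eq_or_disjoint[OF q] ab' by (metis orbit_eq_iff q)
  have qb: "orbit p a - orbit q a = orbit q b" using orb disj by auto
  have O: "orbit p ` S = insert (orbit p a) (orbit q ` S - {orbit q a, orbit q b})"
    using orbits_transpose_merge[OF q ab' S] pq orb by simp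
  have "orbit p a \<notin> orbit q ` S"
    unfolding orb using q ab' by (rule union_orbits_notin)
  then have "orbit p ` S - {orbit p a} = orbit q ` S - {orbit q a, orbit q b}"
    using O by auto
  then show "orbit (transpose a b \<circ> p) ` S
      = insert (orbit (transpose a b \<circ> p) a)
          (insert (orbit p a - orbit (transpose a b \<circ> p) a) (orbit p ` S - {orbit p a}))"
    unfolding q_def[symmetric] qb using S by auto
  show "card (orbit (transpose a b \<circ> p) ` S) = Suc (card (orbit p ` S))" if "finite S"
    using card_orbits_transpose_merge[OF q ab' S that] pq by (simp add: q_def)
qed

lemma permutes_permutation: "p permutes {1..n::nat} \<Longrightarrow> permutation p"
  by (auto simp: permutation_permutes)

lemma orbit_subset_carrier: "p permutes S \<Longrightarrow> x \<in> S \<Longrightarrow> orbit p x \<subseteq> S"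
  by (rule permutes_orbit_subset)

lemma orbit_fixed_point: "p x = x \<Longrightarrow> orbit p x = {x}"
  by (simp add: orbit_eq_singleton_iff)

lemma finite_orbit_permutation: "permutation p \<Longrightarrow> finite (orbit p x)"
  by (simp add: finite_orbit permutation_self_in_orbit)

text \<open>Inversion turns multiplication on the right into multiplication on the left, and a
  permutation has the same orbits as its inverse. As \<open>b\<close> is a fixed point of
  \<open>p\<close>, this is the merge of the cycle of \<open>a\<close> with
  \<open>{b}\<close>.\<close>

lemma
  assumes p: "p permutes S" and S: "finite S" "a \<in> S" "b \<notin> S"
  shows orbit_append_new: "orbit (p \<circ> transpose a b) b = insert b (orbit p a)"
    and orbits_append: "orbit (p \<circ> transpose a b) ` insert b S
        = insert (insert b (orbit p a)) (orbit p ` S - {orbit p a})"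
    and card_orbits_append: "card (orbit (p \<circ> transpose a b) ` insert b S) = card (orbit p ` S)"
proof -
  have perm: "permutation p" using p S by (auto simp: permutation_permutes)
  have q: "permutation (inv p)" using perm by (rule permutation_inverse)
  have "inv (p \<circ> transpose a b) = transpose a b \<circ> inv p"
    using permutes_bij[OF p] by (simp add: o_inv_distrib)
  moreover have "permutation (p \<circ> transpose a b)"
    using perm by (simp add: permutation_compose permutation_swap_id)
  ultimately have orb: "orbit (p \<circ> transpose a b) x = orbit (transpose a b \<circ> inv p) x" for x
    using orbit_inv_eq by metis
  have inv: "orbit (inv p) x = orbit p x" for x
    using perm by (rule orbit_inv_eq)
  have b: "orbit p b = {b}"
    using p S by (simp add: orbit_fixed_point permutes_not_in)
  have ab: "a \<notin> orbit (inv p) b" using S unfolding inv b by auto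
  have new: "orbit (transpose a b \<circ> inv p) a = insert b (orbit p a)"
    using orbit_transpose_merge[OF q ab] by (simp add: inv b)
  moreover have "permutation (transpose a b \<circ> inv p)"
    using q by (rule permutation_transpose_comp)
  ultimately show "orbit (p \<circ> transpose a b) b = insert b (orbit p a)"
    unfolding orb by (metis insertI1 orbit_eq_iff)
  have "{b} \<notin> orbit p ` S"
    using orbit_subset_carrier[OF p] S by auto
  then have "orbit p ` insert b S - {orbit p a, {b}} = orbit p ` S - {orbit p a}"
    by (auto simp: b)
  then show *: "orbit (p \<circ> transpose a b) ` insert b S
        = insert (insert b (orbit p a)) (orbit p ` S - {orbit p a})"
    using orbits_transpose_merge[OF q ab, of "insert b S"] S unfolding orb inv b by simp
  have "insert b (orbit p a) \<notin> orbit p ` S"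
    using orbit_subset_carrier[OF p] S by auto
  then show "card (orbit (p \<circ> transpose a b) ` insert b S) = card (orbit p ` S)"
    unfolding * using S card_Suc_Diff1[of "orbit p ` S" "orbit p a"] by simp
qed

section \<open>Inserting a new largest point\<close>

definition dual :: "nat \<Rightarrow> (nat \<Rightarrow> nat) \<Rightarrow> nat \<Rightarrow> nat" where
  "dual n \<alpha> = inv \<alpha> \<circ> zeta n"

definition faces :: "nat \<Rightarrow> (nat \<Rightarrow> nat) \<Rightarrow> nat set set" where
  "faces n \<alpha> = orbit (dual n \<alpha>) ` {1..n}"

definition last_face :: "nat \<Rightarrow> (nat \<Rightarrow> nat) \<Rightarrow> nat set" where
  "last_face n \<alpha> = orbit (dual n \<alpha>) n"

text \<open>The result sends \<open>i\<close> to \<open>n + 1\<close> and \<open>n + 1\<close> to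
  the old image of \<open>i\<close>. For \<open>i = n + 1\<close> the transposition is trivial,
  which covers the insertion as a fixed point without a separate definition.\<close>

definition ins :: "nat \<Rightarrow> nat \<Rightarrow> (nat \<Rightarrow> nat) \<Rightarrow> nat \<Rightarrow> nat" where
  "ins n i \<alpha> = \<alpha> \<circ> transpose i (Suc n)"

text \<open>\<open>zeta\<close> itself grows by inserting \<open>n + 1\<close> after
  \<open>n\<close>; this is the origin of the right factor in \<open>dual_ins\<close>.\<close>

lemma zeta_Suc: "1 \<le> n \<Longrightarrow> zeta (Suc n) = zeta n \<circ> transpose n (Suc n)"
  by (auto simp: zeta_def fun_eq_iff transpose_def)

lemma atLeastAtMost_insert: "{1..Suc n} = insert (Suc n) {1..n}"
  by auto

lemma zeta_permutes: "1 \<le> n \<Longrightarrow> zeta n permutes {1..n}"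
proof (induction n rule: dec_induct)
  case base
  have "zeta 1 = id" by (auto simp: zeta_def fun_eq_iff)
  then show ?case using permutes_id by metis
next
  case (step n)
  then have "zeta n permutes {1..Suc n}"
    by (auto intro: permutes_subset)
  then show ?case
    unfolding zeta_Suc[OF step(1)] using step(1) by (intro permutes_compose permutes_swap_id) auto
qed

lemma dual_permutes: "1 \<le> n \<Longrightarrow> \<alpha> permutes {1..n} \<Longrightarrow> dual n \<alpha> permutes {1..n}"
  unfolding dual_def by (intro permutes_compose permutes_inv zeta_permutes)

lemma ins_permutes: "\<alpha> permutes {1..n} \<Longrightarrow> i \<in> {1..Suc n} \<Longrightarrow> ins n i \<alpha> permutes {1..Suc n}"
  unfolding ins_def
  by (intro permutes_compose permutes_swap_id) (auto intro: permutes_subset)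

lemma ins_apply:
  assumes "\<alpha> permutes {1..n}" "i \<in> {1..Suc n}"
  shows "ins n i \<alpha> i = Suc n" "ins n i \<alpha> (Suc n) = \<alpha> i"
    and "x \<noteq> i \<Longrightarrow> x \<noteq> Suc n \<Longrightarrow> ins n i \<alpha> x = \<alpha> x"
  using assms by (auto simp: ins_def transpose_def permutes_not_in)

text \<open>The parameter \<open>i\<close> is recovered as the preimage of \<open>n + 1\<close>, and
  the same transposition applied once more removes \<open>n + 1\<close>.\<close>

lemma bij_betw_ins:
  "bij_betw (\<lambda>(\<alpha>, i). ins n i \<alpha>) ({\<alpha>. \<alpha> permutes {1..n}} \<times> {1..Suc n}) {\<alpha>. \<alpha> permutes {1..Suc n}}"
  unfolding bij_betw_def
proof (intro conjI equalityI subsetI)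
  have inj: "\<alpha> = \<alpha>' \<and> i = j" if "\<alpha> permutes {1..n}" "\<alpha>' permutes {1..n}"
    "i \<in> {1..Suc n}" "j \<in> {1..Suc n}" and eq: "ins n i \<alpha> = ins n j \<alpha>'" for \<alpha> \<alpha>' i j
  proof -
    have "ins n j \<alpha>' i = ins n j \<alpha>' j"
      using ins_apply(1)[of \<alpha> n i] ins_apply(1)[of \<alpha>' n j] that by metis
    then have "i = j"
      using permutes_inj[OF ins_permutes[OF that(2,4)]] by (simp add: inj_eq)
    moreover have "\<alpha> = ins n i \<alpha> \<circ> transpose i (Suc n)" "\<alpha>' = ins n j \<alpha>' \<circ> transpose j (Suc n)"
      by (simp_all add: ins_def comp_assoc)
    ultimately show ?thesis using eq by simp
  qed
  show "inj_on (\<lambda>(\<alpha>, i). ins n i \<alpha>) ({\<alpha>. \<alpha> permutes {1..n}} \<times> {1..Suc n})"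
  proof (rule inj_onI, unfold split_paired_all)
    fix \<alpha> \<alpha>' and i j
    assume "(\<alpha>, i) \<in> {\<alpha>. \<alpha> permutes {1..n}} \<times> {1..Suc n}"
      "(\<alpha>', j) \<in> {\<alpha>. \<alpha> permutes {1..n}} \<times> {1..Suc n}"
      "(case (\<alpha>, i) of (\<alpha>, i) \<Rightarrow> ins n i \<alpha>) = (case (\<alpha>', j) of (\<alpha>, i) \<Rightarrow> ins n i \<alpha>)"
    then show "(\<alpha>, i) = (\<alpha>', j)"
      using inj[of \<alpha> \<alpha>' i j] by (simp del: atLeastAtMost_iff)
  qed
next
  fix \<gamma> assume "\<gamma> \<in> (\<lambda>(\<alpha>, i). ins n i \<alpha>) ` ({\<alpha>. \<alpha> permutes {1..n}} \<times> {1..Suc n})"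
  then show "\<gamma> \<in> {\<alpha>. \<alpha> permutes {1..Suc n}}" using ins_permutes by auto
next
  fix \<gamma> :: "nat \<Rightarrow> nat" assume "\<gamma> \<in> {\<alpha>. \<alpha> permutes {1..Suc n}}"
  then have \<gamma>: "\<gamma> permutes {1..Suc n}" by simp
  define i where "i = inv \<gamma> (Suc n)"
  have i: "i \<in> {1..Suc n}" "\<gamma> i = Suc n"
    using permutes_in_image[OF permutes_inv[OF \<gamma>], of "Suc n"] permutes_inverses(1)[OF \<gamma>]
    by (auto simp: i_def)
  define \<alpha> where "\<alpha> = \<gamma> \<circ> transpose i (Suc n)"
  have "\<alpha> permutes {1..Suc n}"
    unfolding \<alpha>_def using \<gamma> i by (intro permutes_compose permutes_swap_id) auto
  moreover have "\<alpha> x = x" if "x \<in> {1..Suc n} - {1..n}" for x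
  proof -
    have "x = Suc n" using that by auto
    then show ?thesis by (simp add: \<alpha>_def i)
  qed
  ultimately have "\<alpha> permutes {1..n}" by (rule permutes_superset) simp
  moreover have "\<gamma> = ins n i \<alpha>" by (simp add: ins_def \<alpha>_def comp_assoc)
  ultimately show "\<gamma> \<in> (\<lambda>(\<alpha>, i). ins n i \<alpha>) ` ({\<alpha>. \<alpha> permutes {1..n}} \<times> {1..Suc n})"
    using i by auto
qed

section \<open>Cycles and faces after an insertion\<close>

lemma num_cycles_ins:
  assumes \<alpha>: "\<alpha> permutes {1..n}"
  shows "i \<in> {1..n} \<Longrightarrow> num_cycles (Suc n) (ins n i \<alpha>) = num_cycles n \<alpha>"
    and "num_cycles (Suc n) (ins n (Suc n) \<alpha>) = Suc (num_cycles n \<alpha>)"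
proof -
  show "num_cycles (Suc n) (ins n i \<alpha>) = num_cycles n \<alpha>" if "i \<in> {1..n}"
    unfolding num_cycles_def ins_def atLeastAtMost_insert
    using card_orbits_append[OF \<alpha> _ that, of "Suc n"] by simp
  have "orbit \<alpha> (Suc n) = {Suc n}"
    using \<alpha> by (simp add: orbit_fixed_point permutes_not_in)
  moreover have "{Suc n} \<notin> orbit \<alpha> ` {1..n}"
    using orbit_subset_carrier[OF \<alpha>] by force
  ultimately show "num_cycles (Suc n) (ins n (Suc n) \<alpha>) = Suc (num_cycles n \<alpha>)"
    unfolding num_cycles_def ins_def atLeastAtMost_insert by simp
qed

lemma dual_ins:
  assumes "1 \<le> n" "\<alpha> permutes {1..n}"
  shows "dual (Suc n) (ins n i \<alpha>)
    = transpose (Suc n) i \<circ> (dual n \<alpha> \<circ> transpose n (Suc n))"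
  using assms permutes_bij[of \<alpha>]
  by (simp add: dual_def ins_def zeta_Suc o_inv_distrib comp_assoc transpose_commute)

lemma num_cycles_dual: "num_cycles n (dual n \<alpha>) = card (faces n \<alpha>)"
  by (simp add: num_cycles_def faces_def)

lemma last_face_in_faces: "1 \<le> n \<Longrightarrow> last_face n \<alpha> \<in> faces n \<alpha>"
  by (simp add: last_face_def faces_def)

lemma
  assumes n: "1 \<le> n" and \<alpha>: "\<alpha> permutes {1..n}"
  shows last_face_subset: "last_face n \<alpha> \<subseteq> {1..n}"
    and last_face_self: "n \<in> last_face n \<alpha>"
    and finite_last_face: "finite (last_face n \<alpha>)"
    and faces_disjoint: "C \<in> faces n \<alpha> \<Longrightarrow> C \<noteq> last_face n \<alpha> \<Longrightarrow> C \<inter> last_face n \<alpha> = {}"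
    and faces_subset: "C \<in> faces n \<alpha> \<Longrightarrow> C \<subseteq> {1..n}"
    and faces_memD: "C \<in> faces n \<alpha> \<Longrightarrow> x \<in> C \<Longrightarrow> C = orbit (dual n \<alpha>) x"
proof -
  have d: "dual n \<alpha> permutes {1..n}" using n \<alpha> by (rule dual_permutes)
  then have p: "permutation (dual n \<alpha>)" by (rule permutes_permutation)
  show "last_face n \<alpha> \<subseteq> {1..n}" "C \<in> faces n \<alpha> \<Longrightarrow> C \<subseteq> {1..n}"
    using orbit_subset_carrier[OF d] n by (fastforce simp: last_face_def faces_def)+
  then show "finite (last_face n \<alpha>)" by (meson finite_atLeastAtMost finite_subset)
  show "n \<in> last_face n \<alpha>" using p by (simp add: last_face_def permutation_self_in_orbit)
  show "C \<in> faces n \<alpha> \<Longrightarrow> C \<noteq> last_face n \<alpha> \<Longrightarrow> C \<inter> last_face n \<alpha> = {}"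
    using orbit_eq_or_disjoint[OF p] by (auto simp: last_face_def faces_def)
  show "C \<in> faces n \<alpha> \<Longrightarrow> x \<in> C \<Longrightarrow> C = orbit (dual n \<alpha>) x"
    using orbit_eq_iff[OF p] by (auto simp: faces_def)
qed

context
  fixes n :: nat and \<alpha> \<beta> \<beta>' :: "nat \<Rightarrow> nat"
  assumes n: "1 \<le> n" and \<alpha>: "\<alpha> permutes {1..n}"
  defines "\<beta> \<equiv> dual n \<alpha>" and "\<beta>' \<equiv> dual n \<alpha> \<circ> transpose n (Suc n)"
begin

private lemma \<beta>: "\<beta> permutes {1..n}" and perm: "permutation \<beta>" "permutation \<beta>'"
proof -
  show \<beta>: "\<beta> permutes {1..n}"
    unfolding \<beta>_def using n \<alpha> by (rule dual_permutes)
  then show "permutation \<beta>" by (rule permutes_permutation)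
  then show "permutation \<beta>'"
    unfolding \<beta>_def \<beta>'_def by (simp add: permutation_compose permutation_swap_id)
qed

text \<open>\<open>\<beta>'\<close> is the dual after \<open>n + 1\<close> has been appended to the
  last face but before the left transposition of \<open>dual_ins\<close> acts. All three kinds of
  insertion start from these orbits.\<close>

private lemma new: "orbit \<beta>' (Suc n) = insert (Suc n) (last_face n \<alpha>)"
  and orbits: "orbit \<beta>' ` {1..Suc n} = insert (insert (Suc n) (last_face n \<alpha>)) (faces n \<alpha> - {last_face n \<alpha>})"
  and card_orbits: "card (orbit \<beta>' ` {1..Suc n}) = card (faces n \<alpha>)"
  unfolding atLeastAtMost_insert \<beta>'_def last_face_def faces_def \<beta>_def[symmetric]
  using orbit_append_new[OF \<beta>, of n "Suc n"] orbits_append[OF \<beta>, of n "Suc n"]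
    card_orbits_append[OF \<beta>, of n "Suc n"] n by auto

lemma
  shows last_face_ins_fixed: "last_face (Suc n) (ins n (Suc n) \<alpha>) = insert (Suc n) (last_face n \<alpha>)"
    and faces_ins_fixed: "faces (Suc n) (ins n (Suc n) \<alpha>)
      = insert (insert (Suc n) (last_face n \<alpha>)) (faces n \<alpha> - {last_face n \<alpha>})"
    and card_faces_ins_fixed: "card (faces (Suc n) (ins n (Suc n) \<alpha>)) = card (faces n \<alpha>)"
proof -
  have "dual (Suc n) (ins n (Suc n) \<alpha>) = \<beta>'"
    using dual_ins[OF n \<alpha>] by (simp add: \<beta>'_def)
  then show "last_face (Suc n) (ins n (Suc n) \<alpha>) = insert (Suc n) (last_face n \<alpha>)"
    "faces (Suc n) (ins n (Suc n) \<alpha>)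
      = insert (insert (Suc n) (last_face n \<alpha>)) (faces n \<alpha> - {last_face n \<alpha>})"
    "card (faces (Suc n) (ins n (Suc n) \<alpha>)) = card (faces n \<alpha>)"
    unfolding last_face_def[of "Suc n"] faces_def[of "Suc n"] using new orbits card_orbits by simp_all
qed

lemma
  assumes i: "i \<in> {1..n}" "i \<notin> last_face n \<alpha>"
  shows last_face_ins_merge:
      "last_face (Suc n) (ins n i \<alpha>) = insert (Suc n) (last_face n \<alpha> \<union> orbit (dual n \<alpha>) i)"
    and card_faces_ins_merge: "Suc (card (faces (Suc n) (ins n i \<alpha>))) = card (faces n \<alpha>)"
proof -
  have d: "dual (Suc n) (ins n i \<alpha>) = transpose (Suc n) i \<circ> \<beta>'"
    using dual_ins[OF n \<alpha>] by (simp add: \<beta>'_def)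
  have i': "i \<notin> orbit \<beta>' (Suc n)" using i unfolding new by auto
  then have ni: "Suc n \<notin> orbit \<beta>' i" using perm(2) by (metis orbit_eq_iff)
  \<comment> \<open>A \<open>\<beta>'\<close>-orbit that avoids \<open>n + 1\<close> is one of the
    old faces, so it is the old face of \<open>i\<close>.\<close>
  have "orbit \<beta>' i \<in> orbit \<beta>' ` {1..Suc n}" using i by simp
  moreover have "orbit \<beta>' i \<noteq> insert (Suc n) (last_face n \<alpha>)"
    using ni by auto
  ultimately have "orbit \<beta>' i \<in> faces n \<alpha>" unfolding orbits by simp
  then have "orbit \<beta>' i = orbit \<beta> i"
    unfolding \<beta>_def using permutation_self_in_orbit[OF perm(2)] faces_memD[OF n \<alpha>] by blast
  then show "last_face (Suc n) (ins n i \<alpha>) = insert (Suc n) (last_face n \<alpha> \<union> orbit (dual n \<alpha>) i)"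
    unfolding last_face_def[of "Suc n"] d using orbit_transpose_merge[OF perm(2) ni]
    by (simp add: new \<beta>_def)
  show "Suc (card (faces (Suc n) (ins n i \<alpha>))) = card (faces n \<alpha>)"
    unfolding faces_def[of "Suc n"] d
    using card_orbits_transpose_merge[OF perm(2) ni, of "{1..Suc n}"] i card_orbits by simp
qed

text \<open>Times start at 1 and not at 0, so that \<open>n\<close> is reached last. Cutting at time
  \<open>t\<close> then leaves a last face of exactly \<open>t\<close> points: \<open>n + 1\<close>
  and the \<open>t - 1\<close> points reached earlier.\<close>

lemma last_face_eq_image:
  "last_face n \<alpha> = (\<lambda>j. (dual n \<alpha> ^^ j) n) ` {1..card (last_face n \<alpha>)}"
  and inj_on_last_face: "inj_on (\<lambda>j. (dual n \<alpha> ^^ j) n) {1..card (last_face n \<alpha>)}"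
  and last_face_return: "(dual n \<alpha> ^^ card (last_face n \<alpha>)) n = n"
proof -
  define m where "m = least_power \<beta> n"
  have m: "0 < m" "(\<beta> ^^ m) n = n"
    using least_power_of_permutation[OF perm(1)] by (auto simp: m_def)
  have orb: "orbit \<beta> n = {(\<beta> ^^ j) n | j. j < m}"
    using m(2,1) by (rule orbit_altdef_bounded)
  have inj: "inj_on (\<lambda>j. (\<beta> ^^ j) n) {..<m}"
    using cycle_of_permutation[OF perm(1), of n]
    by (auto simp: distinct_map m_def atLeast0LessThan)
  have img: "orbit \<beta> n = (\<lambda>j. (\<beta> ^^ j) n) ` {..<m}"
    using orb by auto
  have card: "card (orbit \<beta> n) = m"
    unfolding img using inj by (simp add: card_image)
  have img': "(\<lambda>j. (\<beta> ^^ j) n) ` {1..m} = (\<lambda>j. (\<beta> ^^ j) n) ` {..<m}"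
  proof (intro equalityI subsetI)
    fix x assume "x \<in> (\<lambda>j. (\<beta> ^^ j) n) ` {1..m}"
    then obtain j where "x = (\<beta> ^^ j) n" "1 \<le> j" "j \<le> m" by auto
    then show "x \<in> (\<lambda>j. (\<beta> ^^ j) n) ` {..<m}"
      using m by (cases "j = m") (auto intro: image_eqI[of _ _ 0] image_eqI[of _ _ j])
  next
    fix x assume "x \<in> (\<lambda>j. (\<beta> ^^ j) n) ` {..<m}"
    then obtain j where "x = (\<beta> ^^ j) n" "j < m" by auto
    then show "x \<in> (\<lambda>j. (\<beta> ^^ j) n) ` {1..m}"
      using m by (cases "j = 0") (auto intro: image_eqI[of _ _ m] image_eqI[of _ _ j])
  qed
  show "last_face n \<alpha> = (\<lambda>j. (dual n \<alpha> ^^ j) n) ` {1..card (last_face n \<alpha>)}"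
    unfolding last_face_def \<beta>_def[symmetric] card img' by (rule img)
  show "inj_on (\<lambda>j. (dual n \<alpha> ^^ j) n) {1..card (last_face n \<alpha>)}"
    unfolding last_face_def \<beta>_def[symmetric] card
    by (rule eq_card_imp_inj_on) (use card img' img in simp_all)
  show "(dual n \<alpha> ^^ card (last_face n \<alpha>)) n = n"
    unfolding last_face_def \<beta>_def[symmetric] card using m by simp
qed

lemma
  assumes t: "1 \<le> t" "t \<le> card (last_face n \<alpha>)"
  defines "i \<equiv> (dual n \<alpha> ^^ t) n"
    and "F \<equiv> insert (Suc n) ((\<lambda>j. (dual n \<alpha> ^^ j) n) ` {1..<t})"
  shows last_face_ins_cut: "last_face (Suc n) (ins n i \<alpha>) = F"
    and faces_ins_cut: "faces (Suc n) (ins n i \<alpha>)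
      = insert F (insert (insert (Suc n) (last_face n \<alpha>) - F) (faces n \<alpha> - {last_face n \<alpha>}))"
    and card_faces_ins_cut: "card (faces (Suc n) (ins n i \<alpha>)) = Suc (card (faces n \<alpha>))"
proof -
  have d: "dual (Suc n) (ins n i \<alpha>) = transpose (Suc n) i \<circ> \<beta>'"
    using dual_ins[OF n \<alpha>] by (simp add: \<beta>'_def)
  have in_range: "(\<beta> ^^ j) n \<in> {1..n}" for j
    using permutes_in_image[OF permutes_funpow[OF \<beta>]] n by simp
  have inj: "j = j'" if "(\<beta> ^^ j) n = (\<beta> ^^ j') n" "1 \<le> j" "j \<le> card (last_face n \<alpha>)"
    "1 \<le> j'" "j' \<le> card (last_face n \<alpha>)" for j j'
    using inj_onD[OF inj_on_last_face that(1)[unfolded \<beta>_def]] that by simp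
  \<comment> \<open>\<open>\<beta>'\<close> enters the old face from \<open>n + 1\<close> at the
    point where \<open>\<beta>\<close> enters it from \<open>n\<close>, and then agrees with
    \<open>\<beta>\<close> until \<open>n\<close> is reached, which does not happen before the whole
    face has been traversed.\<close>
  have chain: "(\<beta>' ^^ j) (Suc n) = (\<beta> ^^ j) n" if "1 \<le> j" "j \<le> t" for j
    using that
  proof (induction j rule: dec_induct)
    case base
    then show ?case by (simp add: \<beta>'_def \<beta>_def)
  next
    case (step j)
    have "(\<beta> ^^ j) n \<noteq> n"
      using inj[of j "card (last_face n \<alpha>)"] last_face_return step t by (auto simp: \<beta>_def)
    moreover have "(\<beta> ^^ j) n \<noteq> Suc n" using in_range[of j] by auto
    ultimately show ?case using step
      by (simp add: \<beta>'_def) (simp add: \<beta>_def transpose_apply_other)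
  qed
  have cut: "orbit (transpose (Suc n) i \<circ> \<beta>') (Suc n) = (\<lambda>j. (\<beta>' ^^ j) (Suc n)) ` {..<t}"
  proof (rule orbit_transpose_cut[OF perm(2)])
    show "0 < t" using t by simp
    show "(\<beta>' ^^ t) (Suc n) = i" using chain[of t] t by (simp add: i_def \<beta>_def)
    fix j assume j: "0 < j" "j < t"
    then show "(\<beta>' ^^ j) (Suc n) \<noteq> Suc n \<and> (\<beta>' ^^ j) (Suc n) \<noteq> i"
      using chain[of j] in_range[of j] inj[of j t] t by (auto simp: i_def \<beta>_def)
  qed
  also have "{..<t} = insert 0 {1..<t}" using t by auto
  also have "(\<lambda>j. (\<beta>' ^^ j) (Suc n)) ` insert 0 {1..<t} = insert (Suc n) ((\<lambda>j. (\<beta> ^^ j) n) ` {1..<t})"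
    using chain by simp
  finally have F: "orbit (transpose (Suc n) i \<circ> \<beta>') (Suc n) = F" unfolding F_def \<beta>_def .
  then show "last_face (Suc n) (ins n i \<alpha>) = F"
    unfolding last_face_def[of "Suc n"] d .
  have i1: "i \<in> {1..Suc n}" using in_range[of t] by (simp add: i_def \<beta>_def)
  have "i \<notin> F"
  proof
    assume "i \<in> F"
    moreover have "i \<noteq> Suc n" using in_range[of t] by (auto simp: i_def \<beta>_def)
    ultimately obtain j where "i = (\<beta> ^^ j) n" "1 \<le> j" "j < t" by (auto simp: F_def \<beta>_def)
    then show False using inj[of t j] t by (simp add: i_def \<beta>_def)
  qed
  then have i': "i \<notin> orbit (transpose (Suc n) i \<circ> \<beta>') (Suc n)" unfolding F .
  have "insert (Suc n) (last_face n \<alpha>) \<notin> faces n \<alpha>"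
    using faces_subset[OF n \<alpha>] by force
  then have "orbit \<beta>' ` {1..Suc n} - {insert (Suc n) (last_face n \<alpha>)} = faces n \<alpha> - {last_face n \<alpha>}"
    unfolding orbits by auto
  then show "faces (Suc n) (ins n i \<alpha>)
      = insert F (insert (insert (Suc n) (last_face n \<alpha>) - F) (faces n \<alpha> - {last_face n \<alpha>}))"
    unfolding faces_def[of "Suc n"] d
    using orbits_transpose_cut[OF perm(2) i' _ i1] by (simp add: F new)
  show "card (faces (Suc n) (ins n i \<alpha>)) = Suc (card (faces n \<alpha>))"
    unfolding faces_def[of "Suc n"] d
    using card_orbits_transpose_cut[OF perm(2) i' _ i1] card_orbits by simp
qed

end

section \<open>Weak descents\<close>

definition descents :: "nat \<Rightarrow> (nat \<Rightarrow> nat) \<Rightarrow> nat set" where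
  "descents n p = {i \<in> {1..n}. p i \<le> i}"

lemma finite_descents [simp]: "finite (descents n p)"
  by (simp add: descents_def)

text \<open>The maximum of every cycle is a weak descent.\<close>

lemma orbit_image_descents:
  assumes "p permutes {1..n}"
  shows "orbit p ` descents n p = orbit p ` {1..n}"
proof (intro equalityI subsetI)
  fix C assume "C \<in> orbit p ` {1..n}"
  then obtain x where x: "x \<in> {1..n}" "C = orbit p x" by auto
  have p: "permutation p" using assms by (rule permutes_permutation)
  have "C \<subseteq> {1..n}" using x orbit_subset_carrier[OF assms] by simp
  then have fin: "finite C" by (meson finite_atLeastAtMost finite_subset)
  have ne: "C \<noteq> {}" using x orbit_nonempty by simp
  have M: "Max C \<in> C" using fin ne by simp
  then have "p (Max C) \<in> C" using x by (auto intro: orbit.step)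
  then have "p (Max C) \<le> Max C" using fin by simp
  then have "Max C \<in> descents n p" using M \<open>C \<subseteq> {1..n}\<close> by (auto simp: descents_def)
  moreover have "orbit p (Max C) = C"
    using M unfolding x(2) orbit_eq_iff[OF p] .
  ultimately show "C \<in> orbit p ` descents n p" by blast
qed (auto simp: descents_def)

lemma num_cycles_le_descents:
  "p permutes {1..n} \<Longrightarrow> num_cycles n p \<le> card (descents n p)"
  unfolding num_cycles_def using orbit_image_descents[of p n] card_image_le[of "descents n p" "orbit p"]
  by simp

text \<open>Equality in \<open>num_cycles_le_descents\<close> makes the surjection from weak
  descents onto cycles injective.\<close>

lemma card_descents_orbit:
  assumes p: "p permutes {1..n}" and eq: "card (descents n p) = num_cycles n p"
    and C: "C \<in> orbit p ` {1..n}"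
  shows "card {i \<in> C. p i \<le> i} = 1"
proof -
  have inj: "inj_on (orbit p) (descents n p)"
    using eq orbit_image_descents[OF p] by (intro eq_card_imp_inj_on) (auto simp: num_cycles_def)
  obtain x where x: "x \<in> descents n p" "C = orbit p x"
    using C unfolding orbit_image_descents[OF p, symmetric] by blast
  have perm: "permutation p" using p by (rule permutes_permutation)
  have "C \<subseteq> {1..n}" using C orbit_subset_carrier[OF p] by fastforce
  have "{i \<in> C. p i \<le> i} = {x}"
  proof (intro equalityI subsetI)
    fix i assume "i \<in> {i \<in> C. p i \<le> i}"
    then have "i \<in> descents n p" "orbit p i = orbit p x"
      using \<open>C \<subseteq> {1..n}\<close> x orbit_eq_iff[OF perm] by (auto simp: descents_def)
    then show "i \<in> {x}" using inj x by (auto dest: inj_onD)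
  next
    fix i assume "i \<in> {x}"
    then show "i \<in> {i \<in> C. p i \<le> i}"
      using x permutation_self_in_orbit[OF perm] by (auto simp: descents_def)
  qed
  then show ?thesis by simp
qed

context
  fixes n :: nat and \<alpha> :: "nat \<Rightarrow> nat"
  assumes n: "1 \<le> n" and \<alpha>: "\<alpha> permutes {1..n}"
begin

lemma apply_dual: "\<alpha> (dual n \<alpha> j) = zeta n j"
  using \<alpha> by (simp add: dual_def permutes_inverses)

text \<open>For \<open>j < n\<close>, \<open>\<alpha>\<close> maps \<open>dual n \<alpha> j\<close>
  to \<open>j + 1\<close>, so it descends weakly there iff the dual strictly ascends at
  \<open>j\<close>. At \<open>j = n\<close> the cycle \<open>zeta\<close> wraps around to 1, which
  always gives a weak descent and accounts for the extra one in
  \<open>card_descents_dual\<close>.\<close>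

lemma descent_dual_iff:
  assumes "j \<in> {1..n}"
  shows "\<alpha> (dual n \<alpha> j) \<le> dual n \<alpha> j \<longleftrightarrow> j = n \<or> \<not> dual n \<alpha> j \<le> j"
proof -
  have "dual n \<alpha> j \<in> {1..n}"
    using permutes_in_image[OF dual_permutes[OF n \<alpha>]] assms by blast
  then show ?thesis
    using assms by (cases "j = n") (auto simp: apply_dual zeta_def)
qed

lemma descents_eq_dual_image:
  "descents n \<alpha> = dual n \<alpha> ` insert n ({1..n} - descents n (dual n \<alpha>))"
proof -
  have d: "dual n \<alpha> permutes {1..n}" using n \<alpha> by (rule dual_permutes)
  have "i \<in> dual n \<alpha> ` {j \<in> {1..n}. \<alpha> (dual n \<alpha> j) \<le> dual n \<alpha> j}" if "i \<in> descents n \<alpha>" for i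
  proof -
    have "i \<in> dual n \<alpha> ` {1..n}"
      using that unfolding permutes_image[OF d] by (simp add: descents_def)
    then obtain j where "j \<in> {1..n}" "i = dual n \<alpha> j" by blast
    then show ?thesis using that by (auto simp: descents_def)
  qed
  moreover have "dual n \<alpha> j \<in> {1..n}" if "j \<in> {1..n}" for j
    using permutes_in_image[OF d] that by blast
  ultimately have "descents n \<alpha> = dual n \<alpha> ` {j \<in> {1..n}. \<alpha> (dual n \<alpha> j) \<le> dual n \<alpha> j}"
    by (auto simp: descents_def)
  also have "{j \<in> {1..n}. \<alpha> (dual n \<alpha> j) \<le> dual n \<alpha> j} = insert n ({1..n} - descents n (dual n \<alpha>))"
    using n descent_dual_iff by (auto simp: descents_def)
  finally show ?thesis .
qed

lemma card_descents_dual: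
  "card (descents n \<alpha>) + card (descents n (dual n \<alpha>)) = Suc n"
proof -
  have d: "dual n \<alpha> permutes {1..n}" using n \<alpha> by (rule dual_permutes)
  \<comment> \<open>\<open>n\<close> is a weak descent of the dual, so inserting \<open>n\<close>
    into the complement really adds an element.\<close>
  have "dual n \<alpha> n \<le> n"
    using permutes_in_image[OF d, of n] n by auto
  then have "n \<in> descents n (dual n \<alpha>)" using n by (simp add: descents_def)
  moreover have "descents n (dual n \<alpha>) \<subseteq> {1..n}" by (auto simp: descents_def)
  ultimately have "card (insert n ({1..n} - descents n (dual n \<alpha>))) = Suc (n - card (descents n (dual n \<alpha>)))"
    by (simp add: card_Diff_subset)
  moreover have "card (descents n (dual n \<alpha>)) \<le> n"
    using card_mono[OF _ \<open>descents n (dual n \<alpha>) \<subseteq> {1..n}\<close>] by simp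
  moreover have "card (descents n \<alpha>) = card (insert n ({1..n} - descents n (dual n \<alpha>)))"
    unfolding descents_eq_dual_image
    using permutes_inj_on[OF d] by (rule card_image)
  ultimately show ?thesis by simp
qed

text \<open>After the insertion \<open>i\<close> maps to \<open>n + 1\<close> and is no weak descent
  unless \<open>i = n + 1\<close>, while \<open>n + 1\<close> always is one; nothing changes at the
  other points.\<close>

lemma card_descents_ins:
  assumes i: "i \<in> {1..Suc n}"
  shows "card (descents (Suc n) (ins n i \<alpha>)) + (if i \<le> n \<and> \<alpha> i \<le> i then 1 else 0)
    = Suc (card (descents n \<alpha>))"
proof -
  have "\<alpha> i \<le> Suc n"
    using permutes_in_image[OF \<alpha>, of i] i permutes_not_in[OF \<alpha>, of "Suc n"]
    by (cases "i = Suc n") auto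
  then have "x \<in> descents (Suc n) (ins n i \<alpha>) \<longleftrightarrow> x \<in> insert (Suc n) (descents n \<alpha> - {i})" for x
    using ins_apply(1,2)[OF \<alpha> i] ins_apply(3)[OF \<alpha> i, of x] i by (cases "x = Suc n"; cases "x = i") (auto simp: descents_def)
  then have "descents (Suc n) (ins n i \<alpha>) = insert (Suc n) (descents n \<alpha> - {i})" by blast
  moreover have "Suc n \<notin> descents n \<alpha>" by (simp add: descents_def)
  moreover have "i \<in> descents n \<alpha> \<longleftrightarrow> i \<le> n \<and> \<alpha> i \<le> i"
    using i by (auto simp: descents_def)
  moreover have "i \<in> descents n \<alpha> \<Longrightarrow> card (descents n \<alpha>) \<ge> 1"
    by (metis One_nat_def Suc_leI card_gt_0_iff empty_iff finite_descents)
  ultimately show ?thesis by (auto simp: card_Diff_singleton_if)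
qed

end

lemma last_faceE:
  assumes n: "1 \<le> n" and \<alpha>: "\<alpha> permutes {1..n}" and i: "i \<in> last_face n \<alpha>"
  obtains t where "i = (dual n \<alpha> ^^ t) n" "1 \<le> t" "t \<le> card (last_face n \<alpha>)"
proof -
  have "i \<in> (\<lambda>j. (dual n \<alpha> ^^ j) n) ` {1..card (last_face n \<alpha>)}"
    using i last_face_eq_image[OF n \<alpha>] by blast
  then show thesis using that by auto
qed

section \<open>The recursion for permutations of given genus\<close>

text \<open>The genus is not negative; this excludes merges leading into genus zero. As
  \<open>n\<close> grows by one, a fixed point adds a cycle, a cut adds a face, and a merge loses a
  face.\<close>

lemma num_cycles_faces_le:
  assumes "1 \<le> n" "\<alpha> permutes {1..n}"
  shows "num_cycles n \<alpha> + card (faces n \<alpha>) \<le> Suc n"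
  using assms
proof (induction n arbitrary: \<alpha> rule: dec_induct)
  case base
  have "num_cycles 1 \<alpha> \<le> 1" "card (faces 1 \<alpha>) \<le> 1"
    by (simp_all add: num_cycles_def faces_def)
  then show ?case by simp
next
  case (step n)
  obtain \<gamma> i where \<gamma>: "\<gamma> permutes {1..n}" "i \<in> {1..Suc n}" "\<alpha> = ins n i \<gamma>"
    using bij_betw_ins[of n] step.prems unfolding bij_betw_def by force
  note IH = step.IH[OF \<gamma>(1)]
  consider "i = Suc n" | "i \<in> {1..n}" "i \<in> last_face n \<gamma>" | "i \<in> {1..n}" "i \<notin> last_face n \<gamma>"
    using \<gamma> by force
  then show ?case
  proof cases
    case 1
    then show ?thesis
      using IH \<gamma> num_cycles_ins(2)[OF \<gamma>(1)] card_faces_ins_fixed[OF step(1) \<gamma>(1)] by simp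
  next
    case 2
    obtain t where "i = (dual n \<gamma> ^^ t) n" "1 \<le> t" "t \<le> card (last_face n \<gamma>)"
      using last_faceE[OF step(1) \<gamma>(1) 2(2)] .
    then show ?thesis
      using IH \<gamma> num_cycles_ins(1)[OF \<gamma>(1) 2(1)] card_faces_ins_cut[OF step(1) \<gamma>(1)] by simp
  next
    case 3
    then show ?thesis
      using IH \<gamma> num_cycles_ins(1)[OF \<gamma>(1) 3(1)] card_faces_ins_merge[OF step(1) \<gamma>(1) 3] by simp
  qed
qed

text \<open>If \<open>s\<close> is false, the class consists of the permutations without back points: every cycle has
  exactly one weak descent to its minimum, and the back points are the remaining weak descents.\<close>

definition genus_class :: "bool \<Rightarrow> nat \<Rightarrow> nat \<Rightarrow> nat \<Rightarrow> (nat \<Rightarrow> nat) set" where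
  "genus_class s g n f = {\<alpha>. \<alpha> permutes {1..n} \<and> card (faces n \<alpha>) = f
     \<and> num_cycles n \<alpha> + f + 2 * g = Suc n \<and> (s \<or> card (descents n \<alpha>) = num_cycles n \<alpha>)}"

text \<open>For either value of \<open>s\<close>, inserting a new point after the \<open>r\<close>-th active element leaves exactly
  \<open>r\<close> active elements. This common rule is why both classes satisfy the same recursion.\<close>

definition active :: "bool \<Rightarrow> nat \<Rightarrow> (nat \<Rightarrow> nat) \<Rightarrow> nat set" where
  "active s n \<alpha> = {i \<in> last_face n \<alpha>. s \<or> \<alpha> i \<le> i}"

lemma finite_genus_class [simp]: "finite (genus_class s g n f)"
  by (rule finite_subset[OF _ finite_permutations[of "{1..n}"]]) (auto simp: genus_class_def)

lemma genus_class_0_faces: "1 \<le> n \<Longrightarrow> genus_class s g n 0 = {}"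
  by (auto simp: genus_class_def faces_def)

context
  fixes n :: nat and \<alpha> :: "nat \<Rightarrow> nat"
  assumes n: "1 \<le> n" and \<alpha>: "\<alpha> permutes {1..n}"
begin

lemma ins_fixed_in_genus_class:
  "ins n (Suc n) \<alpha> \<in> genus_class s g (Suc n) f \<longleftrightarrow> \<alpha> \<in> genus_class s g n f"
  using ins_permutes[OF \<alpha>, of "Suc n"] \<alpha> num_cycles_ins(2)[OF \<alpha>] card_faces_ins_fixed[OF n \<alpha>]
    card_descents_ins[OF n \<alpha>, of "Suc n"]
  by (auto simp: genus_class_def)

text \<open>A cut leaves the number of cycles unchanged, so for false \<open>s\<close> the weak
  descents must equal the old number of cycles. As weak descents are never fewer than cycles, this
  forces \<open>\<alpha>\<close> into the class and \<open>i\<close> to be a weak descent.\<close>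

lemma ins_cut_in_genus_class:
  assumes i: "i \<in> last_face n \<alpha>"
  shows "ins n i \<alpha> \<in> genus_class s g (Suc n) (Suc f) \<longleftrightarrow> \<alpha> \<in> genus_class s g n f \<and> i \<in> active s n \<alpha>"
proof -
  have i': "i \<in> {1..n}" using i last_face_subset[OF n \<alpha>] by auto
  then have i'': "i \<in> {1..Suc n}" by simp
  have "card (faces (Suc n) (ins n i \<alpha>)) = Suc (card (faces n \<alpha>))"
    using card_faces_ins_cut[OF n \<alpha>] by (metis last_faceE[OF n \<alpha> i])
  then show ?thesis
    using ins_permutes[OF \<alpha> i''] \<alpha> num_cycles_ins(1)[OF \<alpha> i'] i i'
      card_descents_ins[OF n \<alpha> i''] num_cycles_le_descents[OF \<alpha>]
    by (auto simp: genus_class_def active_def split: if_splits)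
qed

text \<open>A merge loses a face without gaining a cycle and hence raises the genus;
  \<open>num_cycles_faces_le\<close> settles the case of genus zero. The condition on weak descents
  arises as for cuts.\<close>

lemma ins_merge_in_genus_class:
  assumes i: "i \<in> {1..n}" "i \<notin> last_face n \<alpha>"
  shows "ins n i \<alpha> \<in> genus_class s g (Suc n) f
    \<longleftrightarrow> g \<noteq> 0 \<and> \<alpha> \<in> genus_class s (g - 1) n (Suc f) \<and> (s \<or> \<alpha> i \<le> i)"
proof -
  have i'': "i \<in> {1..Suc n}" using i by simp
  show ?thesis
    using ins_permutes[OF \<alpha> i''] \<alpha> num_cycles_ins(1)[OF \<alpha> i(1)] i card_faces_ins_merge[OF n \<alpha> i]
      card_descents_ins[OF n \<alpha> i''] num_cycles_le_descents[OF \<alpha>] num_cycles_faces_le[OF n \<alpha>]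
    by (cases g) (auto simp: genus_class_def split: if_splits)
qed

end

text \<open>The weight \<open>\<Phi>\<close> is arbitrary because the recursion is used twice: with
  an indicator of the number of active points, and with the number of other faces of a given
  size.\<close>

lemma sum_genus_class_Suc:
  fixes \<Phi> :: "(nat \<Rightarrow> nat) \<Rightarrow> real"
  assumes n: "1 \<le> n"
  shows "(\<Sum>\<alpha>\<in>genus_class s g (Suc n) (Suc f). \<Phi> \<alpha>)
    = (\<Sum>\<alpha>\<in>genus_class s g n (Suc f). \<Phi> (ins n (Suc n) \<alpha>))
    + (\<Sum>\<alpha>\<in>genus_class s g n f. \<Sum>i\<in>active s n \<alpha>. \<Phi> (ins n i \<alpha>))
    + (if g = 0 then 0 else \<Sum>\<alpha>\<in>genus_class s (g - 1) n (Suc (Suc f)).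
         \<Sum>i | i \<in> {1..n} - last_face n \<alpha> \<and> (s \<or> \<alpha> i \<le> i). \<Phi> (ins n i \<alpha>))"
proof -
  let ?X = "genus_class s g (Suc n) (Suc f)"
  \<comment> \<open>The preimage of the class under insertion is split into fixed points, cuts and
    merges.\<close>
  define T1 where "T1 = genus_class s g n (Suc f) \<times> {Suc n}"
  define T2 where "T2 = Sigma (genus_class s g n f) (active s n)"
  define T3 where "T3 = (if g = 0 then {} else Sigma (genus_class s (g - 1) n (Suc (Suc f)))
      (\<lambda>\<alpha>. {i. i \<in> {1..n} - last_face n \<alpha> \<and> (s \<or> \<alpha> i \<le> i)}))"
  let ?P = "{\<alpha>. \<alpha> permutes {1..n}} \<times> {1..Suc n}"
  have perm: "\<alpha> permutes {1..n}" if "\<alpha> \<in> genus_class s g n f" for \<alpha> g f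
    using that by (simp add: genus_class_def)
  have act: "i \<in> {1..n}" if "\<alpha> \<in> genus_class s g n f" "i \<in> last_face n \<alpha>" for \<alpha> i g f
    using last_face_subset[OF n perm[OF that(1)]] that(2) by auto
  have T: "T1 \<union> T2 \<union> T3 \<subseteq> ?P"
    using perm act by (fastforce simp: T1_def T2_def T3_def active_def split: if_splits)
  have mem: "ins n i \<alpha> \<in> ?X \<longleftrightarrow> (\<alpha>, i) \<in> T1 \<union> T2 \<union> T3" if a: "\<alpha> permutes {1..n}" and i: "i \<in> {1..Suc n}" for \<alpha> i
  proof -
    consider "i = Suc n" | "i \<in> {1..n}" "i \<in> last_face n \<alpha>" | "i \<in> {1..n}" "i \<notin> last_face n \<alpha>"
      using i by force
    then show ?thesis
    proof cases
      case 1
      then show ?thesis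
        using ins_fixed_in_genus_class[OF n a] last_face_subset[OF n a]
        by (auto simp: T1_def T2_def T3_def active_def)
    next
      case 2
      then show ?thesis
        using ins_cut_in_genus_class[OF n a 2(2)] by (auto simp: T1_def T2_def T3_def)
    next
      case 3
      then show ?thesis
        using ins_merge_in_genus_class[OF n a 3] by (auto simp: T1_def T2_def T3_def active_def)
    qed
  qed
  have "bij_betw (\<lambda>(\<alpha>, i). ins n i \<alpha>) (T1 \<union> T2 \<union> T3) ?X"
    unfolding bij_betw_def
  proof (intro conjI equalityI subsetI)
    show "inj_on (\<lambda>(\<alpha>, i). ins n i \<alpha>) (T1 \<union> T2 \<union> T3)"
      using bij_betw_ins[of n] T by (meson bij_betw_def inj_on_subset)
  next
    fix \<gamma> assume "\<gamma> \<in> (\<lambda>(\<alpha>, i). ins n i \<alpha>) ` (T1 \<union> T2 \<union> T3)"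
    then obtain \<alpha> i where *: "(\<alpha>, i) \<in> T1 \<union> T2 \<union> T3" "\<gamma> = ins n i \<alpha>" by auto
    then have "\<alpha> permutes {1..n}" "i \<in> {1..Suc n}" using T by auto
    then show "\<gamma> \<in> ?X" using mem * by blast
  next
    fix \<gamma> assume \<gamma>: "\<gamma> \<in> ?X"
    then have "\<gamma> permutes {1..Suc n}" by (simp add: genus_class_def)
    then have "\<gamma> \<in> (\<lambda>(\<alpha>, i). ins n i \<alpha>) ` ?P"
      using bij_betw_ins[of n] by (simp add: bij_betw_def)
    then obtain \<alpha> i where *: "\<alpha> permutes {1..n}" "i \<in> {1..Suc n}" "\<gamma> = ins n i \<alpha>" by auto
    then have "(\<alpha>, i) \<in> T1 \<union> T2 \<union> T3" using mem \<gamma> by blast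
    then show "\<gamma> \<in> (\<lambda>(\<alpha>, i). ins n i \<alpha>) ` (T1 \<union> T2 \<union> T3)" using * by force
  qed
  then have "(\<Sum>\<alpha>\<in>?X. \<Phi> \<alpha>) = (\<Sum>(\<alpha>, i)\<in>T1 \<union> T2 \<union> T3. \<Phi> (ins n i \<alpha>))"
    by (simp add: sum.reindex_bij_betw[symmetric] case_prod_unfold)
  also have "\<dots> = (\<Sum>(\<alpha>, i)\<in>T1. \<Phi> (ins n i \<alpha>)) + (\<Sum>(\<alpha>, i)\<in>T2. \<Phi> (ins n i \<alpha>))
      + (\<Sum>(\<alpha>, i)\<in>T3. \<Phi> (ins n i \<alpha>))"
  proof -
    have "finite ?P" by (simp add: finite_permutations)
    then have fin: "finite T1" "finite T2" "finite T3"
      using T by (auto intro: finite_subset)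
    have "T1 \<inter> T2 = {}" "(T1 \<union> T2) \<inter> T3 = {}"
      using act by (fastforce simp: T1_def T2_def T3_def active_def split: if_splits)+
    then show ?thesis using fin by (simp add: sum.union_disjoint)
  qed
  also have "(\<Sum>(\<alpha>, i)\<in>T1. \<Phi> (ins n i \<alpha>)) = (\<Sum>\<alpha>\<in>genus_class s g n (Suc f). \<Phi> (ins n (Suc n) \<alpha>))"
    unfolding T1_def by (subst sum.cartesian_product[symmetric]) simp
  also have "(\<Sum>(\<alpha>, i)\<in>T2. \<Phi> (ins n i \<alpha>)) = (\<Sum>\<alpha>\<in>genus_class s g n f. \<Sum>i\<in>active s n \<alpha>. \<Phi> (ins n i \<alpha>))"
    unfolding T2_def using perm finite_last_face[OF n]
    by (subst sum.Sigma) (auto simp: active_def)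
  also have "(\<Sum>(\<alpha>, i)\<in>T3. \<Phi> (ins n i \<alpha>)) = (if g = 0 then 0
      else \<Sum>\<alpha>\<in>genus_class s (g - 1) n (Suc (Suc f)).
         \<Sum>i | i \<in> {1..n} - last_face n \<alpha> \<and> (s \<or> \<alpha> i \<le> i). \<Phi> (ins n i \<alpha>))"
    unfolding T3_def by (simp add: sum.Sigma)
  finally show ?thesis .
qed

section \<open>Active points and face sizes under insertion\<close>

lemma sum_rank:
  fixes \<phi> :: "nat \<Rightarrow> real"
  assumes "finite T"
  shows "(\<Sum>j\<in>T. \<phi> (Suc (card {k \<in> T. k < j}))) = (\<Sum>r = 1..card (T :: nat set). \<phi> r)"
  using assms
proof (induction T rule: finite_linorder_max_induct)
  case (insert b A)
  have "{k \<in> insert b A. k < b} = A" using insert by auto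
  moreover have "{k \<in> insert b A. k < j} = {k \<in> A. k < j}" if "j \<in> A" for j
    using insert that by auto
  moreover have "b \<notin> A" using insert by auto
  ultimately show ?case using insert by simp
qed simp

text \<open>The last face is left out because it is the partner in every merge and is measured
  separately by its own size.\<close>

definition face_count :: "nat \<Rightarrow> nat \<Rightarrow> (nat \<Rightarrow> nat) \<Rightarrow> nat" where
  "face_count l n \<alpha> = card {C \<in> faces n \<alpha> - {last_face n \<alpha>}. card C = l}"

context
  fixes n :: nat and \<alpha> :: "nat \<Rightarrow> nat"
  assumes n: "1 \<le> n" and \<alpha>: "\<alpha> permutes {1..n}"
begin

lemma finite_active: "finite (active s n \<alpha>)"
  using finite_last_face[OF n \<alpha>] by (simp add: active_def)

lemma ins_le_Suc: "i \<in> {1..Suc n} \<Longrightarrow> ins n i \<alpha> (Suc n) \<le> Suc n"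
  using permutes_in_image[OF ins_permutes[OF \<alpha>], of i "Suc n"] by simp

lemma card_active_ins_fixed: "card (active s (Suc n) (ins n (Suc n) \<alpha>)) = Suc (card (active s n \<alpha>))"
proof -
  have "active s (Suc n) (ins n (Suc n) \<alpha>) = insert (Suc n) (active s n \<alpha>)"
    using ins_le_Suc[of "Suc n"] last_face_subset[OF n \<alpha>] ins_apply(3)[OF \<alpha>, of "Suc n"]
    unfolding active_def last_face_ins_fixed[OF n \<alpha>] by auto
  moreover have "Suc n \<notin> active s n \<alpha>"
    using last_face_subset[OF n \<alpha>] by (auto simp: active_def)
  ultimately show ?thesis using finite_active by simp
qed

lemma card_active_ins_cut:
  assumes t: "1 \<le> t" "t \<le> card (last_face n \<alpha>)"
  shows "card (active s (Suc n) (ins n ((dual n \<alpha> ^^ t) n) \<alpha>))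
    = Suc (card {j \<in> {1..<t}. s \<or> \<alpha> ((dual n \<alpha> ^^ j) n) \<le> (dual n \<alpha> ^^ j) n})" (is "_ = Suc (card ?J)")
proof -
  let ?c = "\<lambda>j. (dual n \<alpha> ^^ j) n"
  have lf: "?c j \<in> {1..n}" for j
    using permutes_in_image[OF permutes_funpow[OF dual_permutes[OF n \<alpha>]]] n by simp
  have i: "?c t \<in> {1..Suc n}" using lf[of t] by simp
  have ne: "?c j \<noteq> ?c t" if "j \<in> {1..<t}" for j
    using inj_on_last_face[OF n \<alpha>] t that by (auto dest: inj_onD)
  have inj: "inj_on ?c {1..<t}"
    by (rule inj_on_subset[OF inj_on_last_face[OF n \<alpha>]]) (use t in auto)
  have same: "ins n (?c t) \<alpha> (?c j) = \<alpha> (?c j)" if "j \<in> {1..<t}" for j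
    using lf[of j] ne[OF that] by (intro ins_apply(3)[OF \<alpha> i]) auto
  have "active s (Suc n) (ins n (?c t) \<alpha>) = insert (Suc n) (?c ` ?J)"
    using ins_le_Suc[OF i] same unfolding active_def last_face_ins_cut[OF n \<alpha> t] by auto
  moreover have "Suc n \<notin> ?c ` ?J"
  proof
    assume "Suc n \<in> ?c ` ?J"
    then obtain j where "Suc n = ?c j" by blast
    then show False using lf[of j] by simp
  qed
  moreover have "card (?c ` ?J) = card ?J"
    using inj by (intro card_image) (auto intro: inj_on_subset)
  ultimately show ?thesis by simp
qed

text \<open>List the last face by the times at which the dual reaches its points. A cut keeps the
  earlier active points and adds \<open>n + 1\<close>, so the new number of active points is the
  rank of the cut point among the active ones.\<close>

lemma sum_active_cut:
  fixes \<phi> :: "nat \<Rightarrow> real"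
  shows "(\<Sum>i\<in>active s n \<alpha>. \<phi> (card (active s (Suc n) (ins n i \<alpha>)))) = (\<Sum>t = 1..card (active s n \<alpha>). \<phi> t)"
proof -
  let ?c = "\<lambda>j. (dual n \<alpha> ^^ j) n" and ?m = "card (last_face n \<alpha>)"
  define T where "T = {j \<in> {1..?m}. s \<or> \<alpha> (?c j) \<le> ?c j}"
  have "active s n \<alpha> = {i \<in> A. s \<or> \<alpha> i \<le> i}" if "last_face n \<alpha> = A" for A
    using that by (simp add: active_def)
  from this[OF last_face_eq_image[OF n \<alpha>]] have "active s n \<alpha> = ?c ` T"
    by (auto simp: T_def)
  moreover have "inj_on ?c T"
    by (rule inj_on_subset[OF inj_on_last_face[OF n \<alpha>]]) (auto simp: T_def)
  ultimately have bij: "bij_betw ?c T (active s n \<alpha>)" by (simp add: bij_betw_def)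
  have "card (active s (Suc n) (ins n (?c j) \<alpha>)) = Suc (card {k \<in> T. k < j})" if "j \<in> T" for j
  proof -
    have "{k \<in> T. k < j} = {k \<in> {1..<j}. s \<or> \<alpha> (?c k) \<le> ?c k}"
      using that by (auto simp: T_def)
    then show ?thesis using card_active_ins_cut[of j s] that by (simp add: T_def)
  qed
  then have "(\<Sum>i\<in>active s n \<alpha>. \<phi> (card (active s (Suc n) (ins n i \<alpha>)))) = (\<Sum>j\<in>T. \<phi> (Suc (card {k \<in> T. k < j})))"
    unfolding sum.reindex_bij_betw[OF bij, symmetric] by (intro sum.cong) auto
  also have "\<dots> = (\<Sum>t = 1..card T. \<phi> t)"
    by (rule sum_rank) (simp add: T_def)
  also have "card T = card (active s n \<alpha>)"
    using bij by (rule bij_betw_same_card)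
  finally show ?thesis .
qed

lemma finite_faces: "finite (faces n \<alpha>)"
  by (simp add: faces_def)

lemma face_count_ins_fixed: "face_count l (Suc n) (ins n (Suc n) \<alpha>) = face_count l n \<alpha>"
proof -
  have "insert (Suc n) (last_face n \<alpha>) \<notin> faces n \<alpha>"
    using faces_subset[OF n \<alpha>] by force
  then have "faces (Suc n) (ins n (Suc n) \<alpha>) - {last_face (Suc n) (ins n (Suc n) \<alpha>)} = faces n \<alpha> - {last_face n \<alpha>}"
    unfolding last_face_ins_fixed[OF n \<alpha>] faces_ins_fixed[OF n \<alpha>] by auto
  then show ?thesis by (simp add: face_count_def)
qed

lemma active_True: "active True n \<alpha> = last_face n \<alpha>"
  by (simp add: active_def)

text \<open>A cut splits the last face, enlarged by \<open>n + 1\<close>, into the new last face and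
  the remainder \<open>N\<close>. Apart from the last face, \<open>N\<close> is the only new face,
  and its size is the difference.\<close>

lemma face_count_ins_cut:
  assumes i: "i \<in> last_face n \<alpha>"
  shows "face_count l (Suc n) (ins n i \<alpha>) = face_count l n \<alpha>
    + (if Suc (card (last_face n \<alpha>)) - card (last_face (Suc n) (ins n i \<alpha>)) = l then 1 else 0)"
proof -
  obtain t where t: "i = (dual n \<alpha> ^^ t) n" "1 \<le> t" "t \<le> card (last_face n \<alpha>)"
    using last_faceE[OF n \<alpha> i] .
  let ?c = "\<lambda>j. (dual n \<alpha> ^^ j) n" and ?m = "card (last_face n \<alpha>)"
  define F where "F = insert (Suc n) (?c ` {1..<t})"
  define N where "N = insert (Suc n) (last_face n \<alpha>) - F"
  have img: "last_face n \<alpha> = ?c ` {1..?m}" using last_face_eq_image[OF n \<alpha>] .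
  have F': "last_face (Suc n) (ins n i \<alpha>) = F"
    unfolding t(1) F_def by (rule last_face_ins_cut[OF n \<alpha> t(2,3)])
  have "?c ` {1..<t} \<subseteq> ?c ` {1..?m}" using t by auto
  then have "F \<subseteq> insert (Suc n) (last_face n \<alpha>)"
    unfolding img[symmetric] by (auto simp: F_def)
  then have cardN: "card N = Suc ?m - card F"
    using finite_last_face[OF n \<alpha>] last_face_subset[OF n \<alpha>]
    by (subst N_def, subst card_Diff_subset) (auto intro: finite_subset simp: card_insert_if)
  have "?c t \<notin> F"
  proof
    assume "?c t \<in> F"
    moreover have "?c t \<noteq> Suc n" using i t(1) last_face_subset[OF n \<alpha>] by auto
    ultimately obtain j where "?c t = ?c j" "1 \<le> j" "j < t" by (auto simp: F_def)
    then show False using inj_onD[OF inj_on_last_face[OF n \<alpha>], of t j] t by simp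
  qed
  then have iN: "i \<in> N" using i t(1) by (simp add: N_def)
  have N_new: "N \<notin> faces n \<alpha> - {last_face n \<alpha>}"
    using iN i faces_disjoint[OF n \<alpha>] by auto
  have "Suc n \<in> F" "Suc n \<notin> N" by (simp_all add: F_def N_def)
  then have "F \<notin> faces n \<alpha>" "F \<noteq> N" using faces_subset[OF n \<alpha>] by (force, auto)
  then have "faces (Suc n) (ins n i \<alpha>) - {last_face (Suc n) (ins n i \<alpha>)}
      = insert N (faces n \<alpha> - {last_face n \<alpha>})"
    unfolding F' unfolding t(1) faces_ins_cut[OF n \<alpha> t(2,3)] F_def[symmetric] N_def[symmetric] by auto
  then have "face_count l (Suc n) (ins n i \<alpha>) = card {C \<in> insert N (faces n \<alpha> - {last_face n \<alpha>}). card C = l}"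
    by (simp only: face_count_def)
  moreover have "{C \<in> insert N (faces n \<alpha> - {last_face n \<alpha>}). card C = l}
      = (if card N = l then insert N else id) {C \<in> faces n \<alpha> - {last_face n \<alpha>}. card C = l}"
    by auto
  ultimately show ?thesis
    using N_new finite_faces unfolding F' cardN[symmetric] by (simp add: face_count_def del: insert_iff)
qed

end

text \<open>Exactly the \<open>x\<close> with \<open>h x \<ge> t\<close> contribute, once each. This
  turns sums over cut points into tail sums over the old size.\<close>

lemma sum_active_eq:
  fixes w :: "'a \<Rightarrow> real" and h :: "'a \<Rightarrow> nat"
  assumes "finite X" "\<And>x. x \<in> X \<Longrightarrow> h x \<le> n" "1 \<le> t"
  shows "(\<Sum>x\<in>X. \<Sum>r = 1..h x. if r = t then w x else 0) = (\<Sum>m = t..n. \<Sum>x\<in>X. if h x = m then w x else 0)"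
proof -
  have "(\<Sum>r = 1..h x. if r = t then w x else 0) = (\<Sum>m = t..n. if h x = m then w x else 0)" if "x \<in> X" for x
    using assms(2)[OF that] assms(3) by (auto simp: sum.delta)
  then have "(\<Sum>x\<in>X. \<Sum>r = 1..h x. if r = t then w x else 0) = (\<Sum>x\<in>X. \<Sum>m = t..n. if h x = m then w x else 0)"
    by (rule sum.cong[OF refl])
  also have "\<dots> = (\<Sum>m = t..n. \<Sum>x\<in>X. if h x = m then w x else 0)"
    by (rule sum.swap)
  finally show ?thesis .
qed

definition class_count :: "bool \<Rightarrow> nat \<Rightarrow> nat \<Rightarrow> nat \<Rightarrow> nat \<Rightarrow> real" where
  "class_count s g n f t = (\<Sum>\<alpha>\<in>genus_class s g n f. if card (active s n \<alpha>) = t then 1 else 0)"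

text \<open>Counts genus zero permutations with a marked face of size \<open>l\<close> besides the
  last one: the information on two faces that is needed when they are merged.\<close>

definition pair_count :: "nat \<Rightarrow> nat \<Rightarrow> nat \<Rightarrow> nat \<Rightarrow> real" where
  "pair_count n f t l = (\<Sum>\<alpha>\<in>genus_class True 0 n f. if card (last_face n \<alpha>) = t then real (face_count l n \<alpha>) else 0)"

lemma genus_class_permutes: "\<alpha> \<in> genus_class s g n f \<Longrightarrow> \<alpha> permutes {1..n}"
  by (simp add: genus_class_def)

lemma card_active_le:
  assumes "1 \<le> n" "\<alpha> permutes {1..n}"
  shows "card (active s n \<alpha>) \<le> n"
proof -
  have "active s n \<alpha> \<subseteq> {1..n}" using last_face_subset[OF assms] by (auto simp: active_def)
  then show ?thesis using card_mono[of "{1..n}"] by fastforce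
qed

text \<open>The marked face is either an old one, kept by a cut or by a fixed point, or the
  remainder of the cut. In the last case the face that was cut had \<open>m\<close> points with
  \<open>m + 1 = t + l\<close>.\<close>

lemma pair_count_Suc:
  assumes n: "1 \<le> n" and t: "1 \<le> t" and l: "1 \<le> l"
  shows "pair_count (Suc n) (Suc f) t l = (\<Sum>m = t..n. pair_count n f m l) + pair_count n (Suc f) (t - 1) l
    + class_count True 0 n f (t + l - 1)"
proof -
  let ?h = "\<lambda>\<alpha>. card (last_face n \<alpha>)" and ?X = "genus_class True 0 n"
  note perm = genus_class_permutes
  define \<Phi> where "\<Phi> = (\<lambda>\<alpha>. if card (last_face (Suc n) \<alpha>) = t then real (face_count l (Suc n) \<alpha>) else 0)"
  have "pair_count (Suc n) (Suc f) t l = (\<Sum>\<alpha>\<in>?X (Suc f). \<Phi> (ins n (Suc n) \<alpha>))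
      + (\<Sum>\<alpha>\<in>?X f. \<Sum>i\<in>active True n \<alpha>. \<Phi> (ins n i \<alpha>))"
    unfolding pair_count_def \<Phi>_def[symmetric] using sum_genus_class_Suc[OF n, of \<Phi> True 0 f] by (simp add: \<Phi>_def)
  also have "(\<Sum>\<alpha>\<in>?X (Suc f). \<Phi> (ins n (Suc n) \<alpha>)) = pair_count n (Suc f) (t - 1) l"
    unfolding pair_count_def
  proof (intro sum.cong refl)
    fix \<alpha> assume "\<alpha> \<in> ?X (Suc f)"
    note a = perm[OF this]
    show "\<Phi> (ins n (Suc n) \<alpha>) = (if ?h \<alpha> = t - 1 then real (face_count l n \<alpha>) else 0)"
      using card_active_ins_fixed[OF n a, of True] face_count_ins_fixed[OF n a] t
      by (auto simp: \<Phi>_def active_True[OF n a] active_True[OF _ ins_permutes[OF a]])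
  qed
  also have "(\<Sum>\<alpha>\<in>?X f. \<Sum>i\<in>active True n \<alpha>. \<Phi> (ins n i \<alpha>))
    = (\<Sum>m = t..n. pair_count n f m l) + class_count True 0 n f (t + l - 1)"
  proof -
    have "(\<Sum>i\<in>active True n \<alpha>. \<Phi> (ins n i \<alpha>)) = (\<Sum>r = 1..?h \<alpha>. if r = t then real (face_count l n \<alpha>) else 0)
        + (if ?h \<alpha> = t + l - 1 then 1 else 0)"
      if "\<alpha> \<in> ?X f" for \<alpha>
    proof -
      note a = perm[OF that]
      define \<phi> where "\<phi> = (\<lambda>r. if r = t then real (face_count l n \<alpha>) + (if Suc (?h \<alpha>) - r = l then 1 else 0) else 0)"
      have "\<Phi> (ins n i \<alpha>) = \<phi> (card (active True (Suc n) (ins n i \<alpha>)))" if "i \<in> active True n \<alpha>" for i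
        using that face_count_ins_cut[OF n a, of i l]
        by (simp add: \<Phi>_def \<phi>_def active_def)
      then have "(\<Sum>i\<in>active True n \<alpha>. \<Phi> (ins n i \<alpha>)) = (\<Sum>r = 1..?h \<alpha>. \<phi> r)"
        using sum_active_cut[OF n a, of \<phi> True] by (simp add: active_True[OF n a])
      also have "\<dots> = (\<Sum>r = 1..?h \<alpha>. if r = t then real (face_count l n \<alpha>) else 0)
        + (if ?h \<alpha> = t + l - 1 then 1 else 0)"
        using t l by (auto simp: \<phi>_def sum.delta)
      finally show ?thesis .
    qed
    moreover have "(\<Sum>\<alpha>\<in>?X f. \<Sum>r = 1..?h \<alpha>. if r = t then real (face_count l n \<alpha>) else 0)
      = (\<Sum>m = t..n. pair_count n f m l)"
      unfolding pair_count_def using t card_active_le[OF n perm, of _ True 0 f True]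
      by (intro sum_active_eq) (auto simp: active_def)
    moreover have "(\<Sum>\<alpha>\<in>?X f. if ?h \<alpha> = t + l - 1 then 1 else 0) = class_count True 0 n f (t + l - 1)"
      by (simp add: class_count_def active_def)
    ultimately show ?thesis by (simp add: sum.distrib)
  qed
  finally show ?thesis by simp
qed

definition merge_count :: "bool \<Rightarrow> nat \<Rightarrow> nat \<Rightarrow> nat \<Rightarrow> real" where
  "merge_count s n f t = (\<Sum>\<alpha>\<in>genus_class s 0 n f.
     \<Sum>i | i \<in> {1..n} - last_face n \<alpha> \<and> (s \<or> \<alpha> i \<le> i). if card (active s (Suc n) (ins n i \<alpha>)) = t then 1 else 0)"

lemma class_count_Suc:
  assumes n: "1 \<le> n" and t: "1 \<le> t"
  shows "class_count s 0 (Suc n) (Suc f) t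
      = (\<Sum>m = t..n. class_count s 0 n f m) + class_count s 0 n (Suc f) (t - 1)"
    and "class_count s 1 (Suc n) (Suc f) t
      = (\<Sum>m = t..n. class_count s 1 n f m) + class_count s 1 n (Suc f) (t - 1) + merge_count s n (Suc (Suc f)) t"
proof -
  define \<phi> :: "nat \<Rightarrow> real" where "\<phi> = (\<lambda>r. if r = t then 1 else 0)"
  define \<Phi> where "\<Phi> = (\<lambda>\<alpha>. \<phi> (card (active s (Suc n) \<alpha>)))"
  have 1: "(\<Sum>\<alpha>\<in>genus_class s g n (Suc f). \<Phi> (ins n (Suc n) \<alpha>)) = class_count s g n (Suc f) (t - 1)" for g
    unfolding class_count_def
  proof (intro sum.cong refl)
    fix \<alpha> assume "\<alpha> \<in> genus_class s g n (Suc f)"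
    from card_active_ins_fixed[OF n genus_class_permutes[OF this], of s]
    show "\<Phi> (ins n (Suc n) \<alpha>) = (if card (active s n \<alpha>) = t - 1 then 1 else 0)"
      using t by (auto simp: \<Phi>_def \<phi>_def)
  qed
  have 2: "(\<Sum>\<alpha>\<in>genus_class s g n f. \<Sum>i\<in>active s n \<alpha>. \<Phi> (ins n i \<alpha>)) = (\<Sum>m = t..n. class_count s g n f m)" for g
  proof -
    have "(\<Sum>\<alpha>\<in>genus_class s g n f. \<Sum>i\<in>active s n \<alpha>. \<Phi> (ins n i \<alpha>))
      = (\<Sum>\<alpha>\<in>genus_class s g n f. \<Sum>r = 1..card (active s n \<alpha>). \<phi> r)"
      unfolding \<Phi>_def by (rule sum.cong[OF refl]) (rule sum_active_cut[OF n genus_class_permutes])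
    also have "\<dots> = (\<Sum>m = t..n. class_count s g n f m)"
      unfolding class_count_def \<phi>_def using t card_active_le[OF n genus_class_permutes]
      by (intro sum_active_eq) auto
    finally show ?thesis .
  qed
  show "class_count s 0 (Suc n) (Suc f) t
      = (\<Sum>m = t..n. class_count s 0 n f m) + class_count s 0 n (Suc f) (t - 1)"
    using sum_genus_class_Suc[OF n, of \<Phi> s 0 f] unfolding 1 2
    by (simp add: class_count_def[of s 0 "Suc n"] \<Phi>_def \<phi>_def)
  show "class_count s 1 (Suc n) (Suc f) t
      = (\<Sum>m = t..n. class_count s 1 n f m) + class_count s 1 n (Suc f) (t - 1) + merge_count s n (Suc (Suc f)) t"
    using sum_genus_class_Suc[OF n, of \<Phi> s 1 f] unfolding 1 2
    by (simp add: class_count_def[of s "Suc 0" "Suc n"] merge_count_def \<Phi>_def \<phi>_def)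
qed

section \<open>Merging faces of permutations of genus zero\<close>

context
  fixes n :: nat and \<alpha> :: "nat \<Rightarrow> nat" and s :: bool and f :: nat
  assumes n: "1 \<le> n" and genus0: "\<alpha> \<in> genus_class s 0 n f"
begin

private lemma \<alpha>: "\<alpha> permutes {1..n}"
  using genus0 by (rule genus_class_permutes)

private lemma d: "dual n \<alpha> permutes {1..n}"
  using n \<alpha> by (rule dual_permutes)

text \<open>Weak descents of \<open>\<alpha>\<close> and its dual add up to \<open>n + 1\<close>,
  and in genus zero so do their cycles. As weak descents are never fewer than cycles, equality holds
  for both.\<close>

lemma genus0_descents:
  shows "card (descents n \<alpha>) = num_cycles n \<alpha>"
    and "card (descents n (dual n \<alpha>)) = num_cycles n (dual n \<alpha>)"
  using card_descents_dual[OF n \<alpha>] num_cycles_le_descents[OF \<alpha>] num_cycles_le_descents[OF d] genus0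
  by (auto simp: genus_class_def num_cycles_dual)

lemma genus0_face_dual_descent:
  assumes "C \<in> faces n \<alpha>"
  shows "card {j \<in> C. dual n \<alpha> j \<le> j} = 1"
  using card_descents_orbit[OF d genus0_descents(2)] assms by (simp add: faces_def)

lemma dual_image_face:
  assumes "C \<in> faces n \<alpha>"
  shows "dual n \<alpha> ` C = C"
proof -
  obtain x where x: "C = orbit (dual n \<alpha>) x" using assms by (auto simp: faces_def)
  have "dual n \<alpha> ` C \<subseteq> C" unfolding x by (auto intro: orbit.step)
  moreover have "finite C" using faces_subset[OF n \<alpha> assms] by (rule finite_subset) simp
  ultimately show ?thesis
    using permutes_inj_on[OF d] by (intro endo_inj_surj)
qed

text \<open>The single weak descent of the dual on this face is \<open>n\<close>, the one exception
  in \<open>descent_dual_iff\<close>. So every point of the face is the image of a point that yields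
  a weak descent of \<open>\<alpha>\<close>.\<close>

lemma genus0_descent_last_face:
  assumes "i \<in> last_face n \<alpha>"
  shows "\<alpha> i \<le> i"
proof -
  note lf = last_face_in_faces[OF n, of \<alpha>]
  have "i \<in> dual n \<alpha> ` last_face n \<alpha>"
    using assms dual_image_face[OF lf] by simp
  then obtain j where j: "i = dual n \<alpha> j" "j \<in> last_face n \<alpha>" by blast
  have jn: "j \<in> {1..n}" using j last_face_subset[OF n \<alpha>] by auto
  have "j = n" if "dual n \<alpha> j \<le> j"
  proof -
    have "dual n \<alpha> n \<le> n" using permutes_in_image[OF d, of n] n by simp
    then have "{j, n} \<subseteq> {j \<in> last_face n \<alpha>. dual n \<alpha> j \<le> j}"
      using j that last_face_self[OF n \<alpha>] by auto
    moreover have "card {j \<in> last_face n \<alpha>. dual n \<alpha> j \<le> j} = 1"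
      using lf by (rule genus0_face_dual_descent)
    ultimately show ?thesis by (metis card_1_singletonE insert_subset singletonD)
  qed
  then show ?thesis using descent_dual_iff[OF n \<alpha> jn] j by auto
qed

text \<open>Here the single weak descent of the dual is not \<open>n\<close>, so its image is the
  only point of the face at which \<open>\<alpha>\<close> ascends.\<close>

lemma genus0_card_face_descents:
  assumes C: "C \<in> faces n \<alpha>" "C \<noteq> last_face n \<alpha>"
  shows "Suc (card {i \<in> C. \<alpha> i \<le> i}) = card C"
proof -
  have sub: "C \<subseteq> {1..n}" using faces_subset[OF n \<alpha> C(1)] .
  have fin: "finite C" using sub by (rule finite_subset) simp
  have nC: "n \<notin> C"
    using faces_disjoint[OF n \<alpha> C] last_face_self[OF n \<alpha>] by blast
  have eq: "\<alpha> (dual n \<alpha> j) \<le> dual n \<alpha> j \<longleftrightarrow> \<not> dual n \<alpha> j \<le> j" if "j \<in> C" for j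
    using descent_dual_iff[OF n \<alpha>, of j] that sub nC by auto
  have "{i \<in> C. \<alpha> i \<le> i} = {i \<in> dual n \<alpha> ` C. \<alpha> i \<le> i}"
    by (simp add: dual_image_face[OF C(1)])
  also have "\<dots> = dual n \<alpha> ` {j \<in> C. \<not> dual n \<alpha> j \<le> j}"
    using eq by auto
  finally have "card {i \<in> C. \<alpha> i \<le> i} = card {j \<in> C. \<not> dual n \<alpha> j \<le> j}"
    using permutes_inj_on[OF d] by (simp add: card_image)
  also have "{j \<in> C. \<not> dual n \<alpha> j \<le> j} = C - {j \<in> C. dual n \<alpha> j \<le> j}" by auto
  also have "card \<dots> = card C - 1"
    using fin by (subst card_Diff_subset) (simp_all add: genus0_face_dual_descent[OF C(1)])
  finally show ?thesis
    using fin C(1) by (metis Suc_pred' card_gt_0_iff faces_def imageE orbit_nonempty)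
qed

text \<open>For false \<open>t\<close> exactly two points of the merged face are inactive: the one
  ascent in the face of \<open>i\<close>, and \<open>i\<close> itself, which now maps to
  \<open>n + 1\<close>.\<close>

lemma genus0_card_active_merge:
  assumes i: "i \<in> {1..n}" "i \<notin> last_face n \<alpha>" and t: "t \<or> \<alpha> i \<le> i"
  shows "card (active t (Suc n) (ins n i \<alpha>)) + 2 * (if t then 0 else 1)
    = Suc (card (last_face n \<alpha>) + card (orbit (dual n \<alpha>) i))"
proof -
  define C where "C = orbit (dual n \<alpha>) i"
  have C: "C \<in> faces n \<alpha>" using i by (simp add: C_def faces_def)
  have iC: "i \<in> C"
    using permutation_self_in_orbit[OF permutes_permutation[OF d]] by (simp add: C_def)
  then have C': "C \<noteq> last_face n \<alpha>" using i by auto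
  have sub: "C \<subseteq> {1..n}" using faces_subset[OF n \<alpha> C] .
  have fin: "finite C" "finite (last_face n \<alpha>)"
    using sub finite_last_face[OF n \<alpha>] by (auto intro: finite_subset)
  have disj: "C \<inter> last_face n \<alpha> = {}" using faces_disjoint[OF n \<alpha> C C'] .
  have new: "Suc n \<notin> C" "Suc n \<notin> last_face n \<alpha>" using sub last_face_subset[OF n \<alpha>] by auto
  have lf: "last_face (Suc n) (ins n i \<alpha>) = insert (Suc n) (last_face n \<alpha> \<union> C)"
    unfolding C_def by (rule last_face_ins_merge[OF n \<alpha> i])
  show ?thesis
  proof (cases t)
    case True
    then have "active t (Suc n) (ins n i \<alpha>) = insert (Suc n) (last_face n \<alpha> \<union> C)"
      unfolding lf[symmetric] by (simp add: active_def)
    then show ?thesis using True fin disj new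
      by (simp add: C_def[symmetric] card_Un_disjoint Int_commute)
  next
    case False
    define D where "D = {x \<in> C. \<alpha> x \<le> x}"
    have i': "i \<in> {1..Suc n}" using i by simp
    have "x \<in> active False (Suc n) (ins n i \<alpha>) \<longleftrightarrow> x \<in> insert (Suc n) (last_face n \<alpha> \<union> (D - {i}))" for x
    proof (cases "x = Suc n \<or> x = i")
      case True
      then show ?thesis
        using lf new i ins_le_Suc[OF n \<alpha> i'] ins_apply(1)[OF \<alpha> i'] by (auto simp: active_def D_def)
    next
      case False
      then show ?thesis
        using lf ins_apply(3)[OF \<alpha> i', of x] genus0_descent_last_face[of x] by (auto simp: active_def D_def)
    qed
    then have "active False (Suc n) (ins n i \<alpha>) = insert (Suc n) (last_face n \<alpha> \<union> (D - {i}))" by blast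
    moreover have "(last_face n \<alpha>) \<inter> (D - {i}) = {}" "finite D" "Suc n \<notin> D"
      using disj fin new by (auto simp: D_def)
    moreover have "i \<in> D" using iC t False by (simp add: D_def)
    moreover from this have "card D \<ge> 1"
      using \<open>finite D\<close> by (metis One_nat_def Suc_leI card_gt_0_iff empty_iff)
    moreover have "Suc (card D) = card C"
      unfolding D_def by (rule genus0_card_face_descents[OF C C'])
    ultimately show ?thesis
      using False fin new by (simp add: C_def[symmetric] card_Un_disjoint)
  qed
qed

text \<open>Group the insertion points by face: a face of size \<open>l\<close> offers all its
  \<open>l\<close> points, or its \<open>l - 1\<close> weak descents.\<close>

lemma sum_merge:
  "(\<Sum>i | i \<in> {1..n} - last_face n \<alpha> \<and> (t \<or> \<alpha> i \<le> i). \<phi> (card (orbit (dual n \<alpha>) i)))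
    = (\<Sum>l = 1..n. real (l - (if t then 0 else 1)) * real (face_count l n \<alpha>) * \<phi> l)"
proof -
  define S where "S = {i. i \<in> {1..n} - last_face n \<alpha> \<and> (t \<or> \<alpha> i \<le> i)}"
  define T where "T = faces n \<alpha> - {last_face n \<alpha>}"
  let ?e = "if t then 0 else 1 :: nat" and ?orb = "orbit (dual n \<alpha>)"
  have perm: "permutation (dual n \<alpha>)" using d by (rule permutes_permutation)
  have finT: "finite T" using finite_faces[OF n \<alpha>] by (simp add: T_def)
  have fin: "finite C" and card: "card C \<in> {1..n}" if "C \<in> T" for C
  proof -
    have sub: "C \<subseteq> {1..n}" using that faces_subset[OF n \<alpha>] by (simp add: T_def)
    then show "finite C" by (rule finite_subset) simp
    moreover have "C \<noteq> {}"
      using that orbit_nonempty[of "dual n \<alpha>"] unfolding T_def faces_def by (metis DiffD1 imageE)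
    ultimately show "card C \<in> {1..n}"
      using card_mono[OF _ sub] by (simp add: Suc_leI card_gt_0_iff)
  qed
  have img: "?orb ` S \<subseteq> T"
    using permutation_self_in_orbit[OF perm] by (auto simp: S_def T_def faces_def)
  have fib: "{x \<in> S. ?orb x = C} = {i \<in> C. t \<or> \<alpha> i \<le> i}" if "C \<in> T" for C
  proof -
    have "C \<in> faces n \<alpha>" "C \<noteq> last_face n \<alpha>" using that by (auto simp: T_def)
    note C = faces_subset[OF n \<alpha> this(1)] faces_disjoint[OF n \<alpha> this] faces_memD[OF n \<alpha> this(1)]
    show ?thesis
    proof (intro equalityI subsetI)
      fix x assume "x \<in> {x \<in> S. ?orb x = C}"
      then show "x \<in> {i \<in> C. t \<or> \<alpha> i \<le> i}"
        using permutation_self_in_orbit[OF perm, of x] by (simp add: S_def)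
    next
      fix x assume "x \<in> {i \<in> C. t \<or> \<alpha> i \<le> i}"
      then have x: "x \<in> C" "t \<or> \<alpha> x \<le> x" by auto
      then have "x \<in> {1..n} - last_face n \<alpha>" using C(1,2) by blast
      then show "x \<in> {x \<in> S. ?orb x = C}" using x C(3)[OF x(1)] by (simp add: S_def)
    qed
  qed
  have card_fib: "card {i \<in> C. t \<or> \<alpha> i \<le> i} = card C - ?e" if "C \<in> T" for C
    using that genus0_card_face_descents[of C] by (cases t) (auto simp: T_def)
  have "(\<Sum>i\<in>S. \<phi> (card (?orb i))) = (\<Sum>C\<in>T. \<Sum>x | x \<in> S \<and> ?orb x = C. \<phi> (card (?orb x)))"
    using finT img by (intro sum.group[symmetric]) (auto simp: S_def)
  also have "\<dots> = (\<Sum>C\<in>T. real (card C - ?e) * \<phi> (card C))"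
  proof (rule sum.cong[OF refl])
    fix C assume C: "C \<in> T"
    have "(\<Sum>x | x \<in> S \<and> ?orb x = C. \<phi> (card (?orb x))) = (\<Sum>x | x \<in> S \<and> ?orb x = C. \<phi> (card C))"
      by (rule sum.cong) auto
    also have "\<dots> = real (card C - ?e) * \<phi> (card C)"
      by (simp only: fib[OF C] card_fib[OF C] sum_constant)
    finally show "(\<Sum>x | x \<in> S \<and> ?orb x = C. \<phi> (card (?orb x))) = real (card C - ?e) * \<phi> (card C)" .
  qed
  also have "\<dots> = (\<Sum>l = 1..n. \<Sum>C | C \<in> T \<and> card C = l. real (card C - ?e) * \<phi> (card C))"
    using finT card by (intro sum.group[symmetric]) auto
  also have "\<dots> = (\<Sum>l = 1..n. real (l - ?e) * real (face_count l n \<alpha>) * \<phi> l)"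
  proof (rule sum.cong[OF refl])
    fix l
    have "(\<Sum>C | C \<in> T \<and> card C = l. real (card C - ?e) * \<phi> (card C))
        = (\<Sum>C | C \<in> T \<and> card C = l. real (l - ?e) * \<phi> l)"
      by (rule sum.cong) auto
    then show "(\<Sum>C | C \<in> T \<and> card C = l. real (card C - ?e) * \<phi> (card C))
        = real (l - ?e) * real (face_count l n \<alpha>) * \<phi> l"
      by (simp add: face_count_def T_def)
  qed
  finally show ?thesis unfolding S_def .
qed

end

lemma genus_class_0: "1 \<le> n \<Longrightarrow> genus_class s 0 n f = genus_class True 0 n f"
  using genus0_descents(1)[of n _ True f] by (auto simp: genus_class_def)

lemma merge_count_eq:
  fixes s :: bool
  assumes n: "1 \<le> n"
  defines "e \<equiv> if s then 0 else 1"
  shows "merge_count s n f t = (\<Sum>l = 1..n. real (l - e) * pair_count n f (t + 2 * e - 1 - l) l)"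
proof -
  let ?X = "genus_class True 0 n f" and ?m = "\<lambda>\<alpha>. card (last_face n \<alpha>)"
  have "merge_count s n f t = (\<Sum>\<alpha>\<in>?X. \<Sum>l = 1..n. real (l - e) * real (face_count l n \<alpha>) *
      (if Suc (?m \<alpha> + l) = t + 2 * e then 1 else 0))"
    unfolding merge_count_def genus_class_0[OF n, of s]
  proof (rule sum.cong[OF refl])
    fix \<alpha> assume a: "\<alpha> \<in> ?X"
    have "(\<Sum>i | i \<in> {1..n} - last_face n \<alpha> \<and> (s \<or> \<alpha> i \<le> i).
          if card (active s (Suc n) (ins n i \<alpha>)) = t then 1 else 0)
        = (\<Sum>i | i \<in> {1..n} - last_face n \<alpha> \<and> (s \<or> \<alpha> i \<le> i).
          if Suc (?m \<alpha> + card (orbit (dual n \<alpha>) i)) = t + 2 * e then 1 else (0 :: real))"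
    proof (rule sum.cong[OF refl])
      fix i assume "i \<in> {i. i \<in> {1..n} - last_face n \<alpha> \<and> (s \<or> \<alpha> i \<le> i)}"
      then have "card (active s (Suc n) (ins n i \<alpha>)) + 2 * e
          = Suc (card (last_face n \<alpha>) + card (orbit (dual n \<alpha>) i))"
        using genus0_card_active_merge[OF n a, of i s] by (simp add: e_def)
      then show "(if card (active s (Suc n) (ins n i \<alpha>)) = t then 1 else 0)
        = (if Suc (?m \<alpha> + card (orbit (dual n \<alpha>) i)) = t + 2 * e then 1 else (0 :: real))"
        by auto
    qed
    also have "\<dots> = (\<Sum>l = 1..n. real (l - e) * real (face_count l n \<alpha>) *
      (if Suc (?m \<alpha> + l) = t + 2 * e then 1 else 0))"
      unfolding e_def by (rule sum_merge[OF n a])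
    finally show "(\<Sum>i | i \<in> {1..n} - last_face n \<alpha> \<and> (s \<or> \<alpha> i \<le> i).
          if card (active s (Suc n) (ins n i \<alpha>)) = t then 1 else 0) = \<dots>" .
  qed
  also have "\<dots> = (\<Sum>l = 1..n. \<Sum>\<alpha>\<in>?X. real (l - e) * real (face_count l n \<alpha>) *
      (if Suc (?m \<alpha> + l) = t + 2 * e then 1 else 0))"
    by (rule sum.swap)
  also have "\<dots> = (\<Sum>l = 1..n. real (l - e) * pair_count n f (t + 2 * e - 1 - l) l)"
  proof (rule sum.cong[OF refl])
    fix l
    have "real (l - e) * real (face_count l n \<alpha>) * (if Suc (?m \<alpha> + l) = t + 2 * e then 1 else 0)
        = real (l - e) * (if ?m \<alpha> = t + 2 * e - 1 - l then real (face_count l n \<alpha>) else 0)"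
      if "\<alpha> \<in> ?X" for \<alpha>
    proof -
      note a = genus_class_permutes[OF that]
      \<comment> \<open>Positive size makes the truncated subtraction harmless: where it cuts off,
        both sides of the equivalence are false.\<close>
      have "?m \<alpha> > 0" using last_face_self[OF n a] finite_last_face[OF n a] by (auto simp: card_gt_0_iff)
      then have "Suc (?m \<alpha> + l) = t + 2 * e \<longleftrightarrow> ?m \<alpha> = t + 2 * e - 1 - l" by auto
      then show ?thesis by simp
    qed
    then show "(\<Sum>\<alpha>\<in>?X. real (l - e) * real (face_count l n \<alpha>) *
      (if Suc (?m \<alpha> + l) = t + 2 * e then 1 else 0)) = real (l - e) * pair_count n f (t + 2 * e - 1 - l) l"
      unfolding pair_count_def sum_distrib_left by (intro sum.cong) auto
  qed
  finally show ?thesis .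
qed

section \<open>Closed forms\<close>

text \<open>\<open>p\<close> is the first binomial divided by \<open>g + 1\<close>, which is never
  zero. Writing three neighbouring binomials as multiples of \<open>p\<close> turns recursions into
  polynomial identities, without dividing by a binomial that may vanish.\<close>

lemma binomial_triple:
  assumes "1 \<le> n"
  obtains p :: real where "real ((n - 1) choose g) = (real g + 1) * p"
    "real ((n - 1) choose Suc g) = (real n - 1 - real g) * p" "real (n choose Suc g) = real n * p"
proof -
  obtain m where m: "n = Suc m" using assms by (cases n) auto
  define p where "p = real (m choose g) / (real g + 1)"
  have p: "real (m choose g) = (real g + 1) * p" by (simp add: p_def)
  have "Suc g * (Suc m choose Suc g) = Suc m * (m choose g)" by (rule Suc_times_binomial)
  then have "real (Suc g) * real (Suc m choose Suc g) = real (Suc m) * real (m choose g)"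
    by (metis of_nat_mult)
  also have "\<dots> = real (Suc g) * (real (Suc m) * p)" by (simp add: p algebra_simps)
  finally have n: "real (Suc m choose Suc g) = real (Suc m) * p" by simp
  then have "real (m choose Suc g) = real (Suc m) * p - (real g + 1) * p"
    using p by simp
  then have "real (m choose Suc g) = (real m - real g) * p" by (simp add: algebra_simps)
  then show thesis using that[of p] p n m by (simp add: algebra_simps)
qed

text \<open>The number of compositions of \<open>a\<close> into \<open>b\<close> positive parts. The
  first argument is an integer since it stands for the points left over by given faces, and the
  formulas must vanish when it is negative.\<close>

definition compositions :: "int \<Rightarrow> nat \<Rightarrow> real" where
  "compositions a b = (if a < 0 then 0 else if a = 0 then (if b = 0 then 1 else 0)
     else if b = 0 then 0 else real ((nat a - 1) choose (b - 1)))"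

lemma compositions_neg: "a < 0 \<Longrightarrow> compositions a b = 0"
  by (simp add: compositions_def)

lemma compositions_0_left [simp]: "compositions 0 (Suc b) = 0"
  by (simp add: compositions_def)

lemma compositions_0_right: "compositions a 0 = (if a = 0 then 1 else 0)"
  by (simp add: compositions_def)

lemma compositions_add1: "compositions (a + 1) (Suc (Suc b)) = compositions a (Suc (Suc b)) + compositions a (Suc b)"
proof (cases "a \<le> 0")
  case False
  then obtain m where "a = int (Suc m)" by (metis linorder_not_le pos_int_cases Suc_pred)
  then show ?thesis by (simp add: compositions_def nat_add_distrib)
qed (auto simp: compositions_def)

lemma compositions_add1': "0 \<le> a \<or> 0 < b \<Longrightarrow> compositions (a + 1) (Suc b) = compositions a (Suc b) + compositions a b"
proof (cases b)
  case 0
  moreover assume "0 \<le> a \<or> 0 < b"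
  ultimately show ?thesis by (auto simp: compositions_def)
qed (simp add: compositions_add1)

text \<open>Relates two neighbouring numbers of parts for the same \<open>a\<close>. All
  verifications of closed forms below end in a multiple of this relation between \<open>x\<close>
  and \<open>y\<close>.\<close>

lemma compositions_absorb: "real b * compositions a (Suc b) = (of_int a - real b) * compositions a b"
proof (cases "a \<le> 0 \<or> b = 0")
  case False
  then obtain m c where "a = int (Suc m)" "b = Suc c"
    by (metis Suc_pred linorder_not_le neq0_conv pos_int_cases)
  moreover have "real (Suc c) * real (m choose Suc c) = (real m - real c) * real (m choose c)"
  proof -
    obtain p where "real (m choose c) = (real c + 1) * p" "real (m choose Suc c) = (real m - real c) * p"
      using binomial_triple[of "Suc m" c] by auto
    then show ?thesis by simp
  qed
  ultimately show ?thesis by (simp add: compositions_def nat_add_distrib)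
qed (auto simp: compositions_def)

text \<open>The tail sum telescopes: it suffices to compare the claimed values at \<open>t\<close>
  and \<open>t + 1\<close> and to start at \<open>t = n + 1\<close>, where the sum is empty.\<close>

lemma tail_sum_unique:
  fixes F :: "nat \<Rightarrow> real"
  assumes step: "\<And>t. 1 \<le> t \<Longrightarrow> t \<le> n \<Longrightarrow> F t - B (t - 1) - S t = F (Suc t) - B t - S (Suc t) + A t"
    and last: "F (Suc n) = B n + S (Suc n)"
    and t: "1 \<le> t" "t \<le> Suc n"
  shows "(\<Sum>m = t..n. A m) + B (t - 1) + S t = F t"
  using t(2,1)
proof (induction t rule: inc_induct)
  case base
  then show ?case using last by simp
next
  case (step m)
  then have "(\<Sum>k = m..n. A k) = A m + (\<Sum>k = Suc m..n. A k)"
    by (intro sum.atLeast_Suc_atMost) simp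
  then show ?case using assms(1)[of m] step by simp
qed

section \<open>Boundary values and counts in genus zero\<close>

lemma class_count_0:
  assumes n: "1 \<le> n" shows "class_count s g n 0 t = 0" "class_count s g n f 0 = 0"
proof -
  show "class_count s g n 0 t = 0" using genus_class_0_faces[OF n] by (simp add: class_count_def)
  have "card (active s n \<alpha>) \<noteq> 0" if "\<alpha> \<in> genus_class s g n f" for \<alpha>
  proof -
    note a = genus_class_permutes[OF that]
    have "\<alpha> n \<le> n" using permutes_in_image[OF a, of n] n by simp
    then show ?thesis
      using finite_active[OF n a] last_face_self[OF n a] by (auto simp: active_def)
  qed
  then show "class_count s g n f 0 = 0"
    unfolding class_count_def by (intro sum.neutral) auto
qed

lemma class_count_large:
  assumes n: "1 \<le> n" and t: "n < t" shows "class_count s g n f t = 0"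
  unfolding class_count_def
proof (intro sum.neutral ballI)
  fix \<alpha> assume "\<alpha> \<in> genus_class s g n f"
  from card_active_le[OF n genus_class_permutes[OF this], of s]
  show "(if card (active s n \<alpha>) = t then 1 else 0 :: real) = 0" using t by auto
qed

lemma genus_class_1:
  "genus_class s 0 1 (Suc f) = (if f = 0 then {id} else {})" "genus_class s (Suc g) 1 f = {}"
proof -
  have *: "num_cycles 1 \<alpha> = 1" "card (faces 1 \<alpha>) = 1" for \<alpha> :: "nat \<Rightarrow> nat"
    by (simp_all add: num_cycles_def faces_def)
  have "card (descents 1 id) = 1" by (simp add: descents_def)
  then show "genus_class s 0 1 (Suc f) = (if f = 0 then {id} else {})" "genus_class s (Suc g) 1 f = {}"
    using * by (auto simp: genus_class_def)
qed

text \<open>A refinement of the Narayana numbers: the last face has \<open>t\<close> points, and the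
  other \<open>f\<close> faces compose the remaining \<open>n - t\<close>.\<close>

lemma class_count_genus0:
  assumes "1 \<le> n"
  shows "class_count True 0 n (Suc f) t = real t / real n * real (n choose f) * compositions (int n - int t) f"
  using assms
proof (induction n arbitrary: f t rule: dec_induct)
  case base
  have "last_face 1 id = {1}"
    using last_face_subset[of 1 id] last_face_self[of 1 id] permutes_id[of "{1..1}"] by auto
  then have *: "card (active True 1 id) = 1" by (simp add: active_def)
  show ?case
  proof (cases "f = 0")
    case True
    then show ?thesis using * unfolding class_count_def genus_class_1
      by (auto simp: compositions_0_right)
  next
    case False
    then have "real t * compositions (1 - int t) f * real (1 choose f) = 0"
      by (cases f; cases t) (auto simp: compositions_def)
    then show ?thesis using False unfolding class_count_def genus_class_1 by auto
  qed
next
  case (step n)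
  consider "t = 0" | "t > Suc n" | "1 \<le> t" "t \<le> Suc n" by linarith
  then show ?case
  proof cases
    case 1
    then show ?thesis using class_count_0(2)[of "Suc n"] by simp
  next
    case 2
    then show ?thesis using class_count_large[of "Suc n" t] by (simp add: compositions_neg)
  next
    case 3
    \<comment> \<open>\<open>F\<close> is the claim for \<open>n + 1\<close>, \<open>B\<close> the
      claim for \<open>n\<close> entering through fixed points, and \<open>A\<close> the counts with
      one face less entering through cuts. Genus zero has no source term.\<close>
    define F where "F = (\<lambda>t. real t / real (Suc n) * real (Suc n choose f) * compositions (int (Suc n) - int t) f)"
    define B where "B = (\<lambda>t. real t / real n * real (n choose f) * compositions (int n - int t) f)"
    define A where "A = (\<lambda>t. class_count True 0 n f t)"
    have "(\<Sum>m = t..n. A m) + B (t - 1) + 0 = F t"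
    proof (rule tail_sum_unique[OF _ _ 3])
      fix t assume t: "1 \<le> t" "t \<le> n"
      show "F t - B (t - 1) - 0 = F (Suc t) - B t - 0 + A t"
      proof (cases f)
        case 0
        then show ?thesis using t step(1) class_count_0(1)[OF step(1), of True 0]
          by (auto simp: F_def B_def A_def compositions_0_right divide_simps)
      next
        case (Suc g)
        have A: "A t = real t / real n * real (n choose g) * compositions (int n - int t) g"
          by (simp add: A_def Suc step.IH)
        obtain p where p: "real (Suc n - 1 choose g) = (real g + 1) * p"
          "real (Suc n - 1 choose Suc g) = (real (Suc n) - 1 - real g) * p" "real (Suc n choose Suc g) = real (Suc n) * p"
          using binomial_triple[of "Suc n" g] by auto
        define x y where "x = compositions (int n - int t) f" and "y = compositions (int n - int t) g"
        have xy: "real g * x = (real n - real t - real g) * y"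
          using compositions_absorb[of g "int n - int t"] by (simp add: x_def y_def Suc)
        have x1: "compositions (int n - int t + 1) f = x + y"
          using compositions_add1'[of "int n - int t" g] t by (simp add: x_def y_def Suc)
        have e: "int (Suc n) - int t = int n - int t + 1" "int (Suc n) - int (Suc t) = int n - int t"
          by simp_all
        have e2: "int n - int (t - 1) = int n - int t + 1" using t by (simp add: of_nat_diff)
        have p2: "real (n choose f) = (real n - real g) * p" using p(2) by (simp add: Suc)
        have cancel: "u / real (Suc n) * (real (Suc n) * v) = u * v" for u v by simp
        have "F t = real t * p * (x + y)" "F (Suc t) = (real t + 1) * p * x"
          unfolding F_def e x1 x_def[symmetric] p(3)[folded Suc] cancel by simp_all
        moreover have "real n * B (t - 1) = (real t - 1) * ((real n - real g) * p) * (x + y)"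
          "real n * B t = real t * ((real n - real g) * p) * x"
          unfolding B_def e2 x1 x_def p2 using t by (simp_all add: of_nat_diff)
        moreover have "real n * A t = real t * ((real g + 1) * p) * y"
          using p(1) step(1) by (simp add: A y_def)
        \<comment> \<open>Multiplying by \<open>n\<close> clears the denominators; what is left is
          \<open>p\<close> times the relation \<open>xy\<close>.\<close>
        moreover have "real n * (real t * p * (x + y)) - (real t - 1) * ((real n - real g) * p) * (x + y)
          - real n * ((real t + 1) * p * x) + real t * ((real n - real g) * p) * x - real t * ((real g + 1) * p) * y
          = p * ((real n - real t - real g) * y - real g * x)"
          by (simp add: algebra_simps)
        ultimately have "real n * (F t - B (t - 1) - (F (Suc t) - B t + A t)) = 0"
          using xy by (simp add: right_diff_distrib distrib_left)
        then show ?thesis using step(1) by simp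
      qed
    next
      show "F (Suc n) = B n + 0"
        using step(1) by (cases f) (simp_all add: F_def B_def)
    qed
    then show ?thesis
      using class_count_Suc(1)[OF step(1), of t True f] 3 step.IH by (simp add: F_def A_def B_def)
  qed
qed

lemma pair_count_small:
  assumes n: "1 \<le> n"
  shows "pair_count n 0 t l = 0" "pair_count n (Suc 0) t l = 0" "pair_count n f 0 l = 0"
    and "n < t \<Longrightarrow> pair_count n f t l = 0"
proof -
  show "pair_count n 0 t l = 0"
    using genus_class_0_faces[OF n] by (simp add: pair_count_def)
  show "pair_count n (Suc 0) t l = 0"
    unfolding pair_count_def
  proof (intro sum.neutral ballI)
    fix \<alpha> assume "\<alpha> \<in> genus_class True 0 n (Suc 0)"
    then have "card (faces n \<alpha>) = 1" by (simp add: genus_class_def)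
    then have "faces n \<alpha> = {last_face n \<alpha>}"
      using last_face_in_faces[OF n] by (metis card_1_singletonE singletonD)
    then show "(if card (last_face n \<alpha>) = t then real (face_count l n \<alpha>) else 0) = 0"
      by (simp add: face_count_def)
  qed
  show "pair_count n f 0 l = 0"
    unfolding pair_count_def
  proof (intro sum.neutral ballI)
    fix \<alpha> assume "\<alpha> \<in> genus_class True 0 n f"
    note a = genus_class_permutes[OF this]
    show "(if card (last_face n \<alpha>) = 0 then real (face_count l n \<alpha>) else 0) = 0"
      using last_face_self[OF n a] finite_last_face[OF n a] by auto
  qed
  show "pair_count n f t l = 0" if "n < t"
    unfolding pair_count_def
  proof (intro sum.neutral ballI)
    fix \<alpha> assume "\<alpha> \<in> genus_class True 0 n f"
    note a = genus_class_permutes[OF this]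
    show "(if card (last_face n \<alpha>) = t then real (face_count l n \<alpha>) else 0) = 0"
      using card_active_le[OF n a, of True] that by (auto simp: active_def)
  qed
qed

text \<open>Besides the last and the marked face there are \<open>f\<close> faces, and they compose
  the other \<open>n - t - l\<close> points. This is the only place where \<open>l\<close> enters,
  which makes the later sum over \<open>l\<close> easy.\<close>

lemma pair_count_eq:
  assumes "1 \<le> n" and l: "1 \<le> l"
  shows "pair_count n (Suc (Suc f)) t l
    = real t * real ((n - 1) choose f) * compositions (int n - int t - int l) f"
  using assms(1)
proof (induction n arbitrary: f t rule: dec_induct)
  case base
  have "genus_class True 0 1 (Suc (Suc f)) = {}"
    using genus_class_1(1)[of True "Suc f"] by simp
  then show ?case
    using l by (cases t) (simp_all add: pair_count_def compositions_neg)
next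
  case (step n)
  consider "t = 0" | "t > Suc n" | "1 \<le> t" "t \<le> Suc n" by linarith
  then show ?case
  proof cases
    case 1
    then show ?thesis using pair_count_small(3)[of "Suc n"] by simp
  next
    case 2
    then show ?thesis using pair_count_small(4)[of "Suc n" t] by (simp add: compositions_neg)
  next
    case 3
    define c where "c = (\<lambda>t. compositions (int n - int t - int l))"
    define F where "F = (\<lambda>t. real t * real (n choose f) * c (t - 1) f)"
    define B where "B = (\<lambda>t. real t * real ((n - 1) choose f) * c t f)"
    \<comment> \<open>The source term is \<open>class_count_genus0\<close> at the size
      \<open>t + l - 1\<close> of the face before it was cut.\<close>
    define S where "S = (\<lambda>t. (real t + real l - 1) / real n * real (n choose f) * c (t - 1) f)"
    define A where "A = (\<lambda>t. pair_count n (Suc f) t l)"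
    have "(\<Sum>m = t..n. A m) + B (t - 1) + S t = F t"
    proof (rule tail_sum_unique[OF _ _ 3])
      fix t assume t: "1 \<le> t" "t \<le> n"
      show "F t - B (t - 1) - S t = F (Suc t) - B t - S (Suc t) + A t"
      proof (cases f)
        case 0
        \<comment> \<open>With no further faces the composition number is nonzero for a single
          argument, and there the other factor vanishes.\<close>
        have "c (t - 1) 0 * (real n - real t + 1 - real l) = 0" "c t 0 * (real n - real t - real l) = 0"
          using t by (auto simp: c_def compositions_0_right of_nat_diff)
        then have "real n * (F t - B (t - 1) - S t) = 0" "real n * (F (Suc t) - B t - S (Suc t)) = 0"
          using t step(1) by (simp_all add: F_def B_def S_def 0 of_nat_diff field_simps)
        then show ?thesis
          using step(1) pair_count_small(2)[OF step(1)] by (simp add: A_def 0)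
      next
        case (Suc g)
        have A: "A t = real t * real ((n - 1) choose g) * c t g"
          by (simp add: A_def Suc step.IH c_def)
        obtain p where p: "real (n - 1 choose g) = (real g + 1) * p"
          "real (n - 1 choose Suc g) = (real n - 1 - real g) * p" "real (n choose Suc g) = real n * p"
          using binomial_triple[OF step(1), of g] .
        define x y where "x = c t f" and "y = c t g"
        have xy: "real g * x = (real n - real t - real l - real g) * y"
          using compositions_absorb[of g "int n - int t - int l"] by (simp add: x_def y_def c_def Suc)
        show ?thesis
        \<comment> \<open>\<open>compositions_add1'\<close> is applied when the argument is
          nonnegative or \<open>g > 0\<close>; in the other case every term is zero.\<close>
        proof (cases "g = 0 \<and> n < t + l")
          case True
          have "x = 0" "y = 0" using True by (auto simp: x_def y_def c_def compositions_neg)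
          have "c (t - 1) f = 0"
          proof (cases "n + 1 = t + l")
            case True
            then have "int n - int (t - 1) - int l = 0" using t by (simp add: of_nat_diff)
            then show ?thesis by (simp add: c_def Suc)
          next
            case False
            then have "int n - int (t - 1) - int l < 0"
              using \<open>g = 0 \<and> n < t + l\<close> t by (simp add: of_nat_diff)
            then show ?thesis by (simp add: c_def compositions_neg)
          qed
          then show ?thesis
            using \<open>x = 0\<close> \<open>y = 0\<close> by (simp add: F_def B_def S_def A x_def y_def)
        next
          case False
          have x1: "c (t - 1) f = x + y"
            using compositions_add1'[of "int n - int t - int l" g] False t
            by (auto simp: x_def y_def c_def Suc of_nat_diff algebra_simps)
          have "F t = real t * (real n * p) * (x + y)" "F (Suc t) = (real t + 1) * (real n * p) * x"
            unfolding F_def x1 p(3)[folded Suc] diff_Suc_1 x_def by simp_all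
          moreover have "B (t - 1) = (real t - 1) * ((real n - 1 - real g) * p) * (x + y)"
            "B t = real t * ((real n - 1 - real g) * p) * x"
            using t unfolding B_def x1 p(2)[folded Suc] x_def by (simp_all add: of_nat_diff)
          moreover have "S t = (real t + real l - 1) * p * (x + y)" "S (Suc t) = (real t + real l) * p * x"
            using step(1) unfolding S_def x1 p(3)[folded Suc] diff_Suc_1 x_def by simp_all
          moreover have "A t = real t * ((real g + 1) * p) * y"
            unfolding A y_def p(1) by simp
          moreover have "real t * (real n * p) * (x + y) - (real t - 1) * ((real n - 1 - real g) * p) * (x + y)
              - (real t + real l - 1) * p * (x + y)
              - (real t + 1) * (real n * p) * x + real t * ((real n - 1 - real g) * p) * x
              + (real t + real l) * p * x - real t * ((real g + 1) * p) * y
            = p * ((real n - real t - real l - real g) * y - real g * x)"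
            by (simp add: algebra_simps)
          ultimately show ?thesis using xy by simp
        qed
      qed
    next
      have "c n f = 0" using l by (simp add: c_def compositions_neg)
      then show "F (Suc n) = B n + S (Suc n)"
        by (simp add: F_def B_def S_def)
    qed
    moreover have "pair_count (Suc n) (Suc (Suc f)) t l = (\<Sum>m = t..n. A m) + B (t - 1) + S t"
      using pair_count_Suc[OF step(1) 3(1) l, of "Suc f"] class_count_genus0[OF step(1), of f "t + l - 1"]
        3(1) l by (simp add: A_def B_def S_def c_def step.IH of_nat_diff algebra_simps)
    moreover have "int (Suc n) - int t - int l = int n - int (t - 1) - int l"
      using 3(1) by (simp add: of_nat_diff)
    ultimately show ?thesis by (simp only: F_def c_def diff_Suc_1)
  qed
qed

text \<open>The values are \<open>L + 1\<close> choose 3 and \<open>L\<close> choose 3. The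
  truncated \<open>L - l\<close> silences the terms with \<open>l > L\<close>.\<close>

lemma sum_products:
  assumes "L \<le> n"
  shows "(\<Sum>l = 1..n. real l * real (L - l)) = (real L + 1) * real L * (real L - 1) / 6"
    and "(\<Sum>l = 1..n. real (l - 1) * real (L - l)) = real L * (real L - 1) * (real L - 2) / 6"
proof -
  have *: "(\<Sum>l = 1..n. real (l - e) * real (L - l)) = (\<Sum>l = 1..L. real (l - e) * (real L - real l))" for e
  proof -
    have "(\<Sum>l = 1..n. real (l - e) * real (L - l)) = (\<Sum>l = 1..L. real (l - e) * real (L - l))"
      using assms by (intro sum.mono_neutral_right) auto
    also have "\<dots> = (\<Sum>l = 1..L. real (l - e) * (real L - real l))"
      by (rule sum.cong) (auto simp: of_nat_diff)
    finally show ?thesis .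
  qed
  \<comment> \<open>\<open>x\<close> is kept apart from the upper limit \<open>m\<close> so that
    induction on \<open>m\<close> works; afterwards both become \<open>L\<close>.\<close>
  have "(\<Sum>l = 1..m. real l * (x - real l)) = x * real m * (real m + 1) / 2 - real m * (real m + 1) * (2 * real m + 1) / 6" for x m
    by (induction m) (simp_all add: field_simps)
  from this[of "real L" L] *[of 0]
  show "(\<Sum>l = 1..n. real l * real (L - l)) = (real L + 1) * real L * (real L - 1) / 6"
    by (simp add: field_simps)
  have "(\<Sum>l = 1..m. real (l - 1) * (x - real l)) = x * real m * (real m - 1) / 2 - real m * (real m + 1) * (real m - 1) / 3" for x m
    by (induction m) (simp_all add: field_simps)
  from this[of "real L" L] *[of 1]
  show "(\<Sum>l = 1..n. real (l - 1) * real (L - l)) = real L * (real L - 1) * (real L - 2) / 6"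
    by (simp add: field_simps)
qed

text \<open>The sizes of the two merged faces add up to the fixed number \<open>L\<close>, so by
  \<open>pair_count_eq\<close> the composition factor leaves the sum over \<open>l\<close>. The
  convolution that remains is \<open>t + e\<close> choose 3.\<close>

lemma merge_count_closed:
  fixes s :: bool
  assumes n: "1 \<le> n" and t: "1 \<le> t"
  defines "e \<equiv> if s then 0 else 1"
  shows "merge_count s n (Suc (Suc f)) t
    = (real t + real e) * (real t + real e - 1) * (real t + real e - 2) / 6
      * real ((n - 1) choose f) * compositions (int n + 1 - int t - 2 * int e) f"
proof -
  define L where "L = t + 2 * e - 1"
  let ?c = "compositions (int n - int L) f"
  have "merge_count s n (Suc (Suc f)) t = (\<Sum>l = 1..n. real (l - e) * pair_count n (Suc (Suc f)) (L - l) l)"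
    unfolding merge_count_eq[OF n] e_def[symmetric] L_def ..
  also have "\<dots> = (\<Sum>l = 1..n. real (l - e) * real (L - l) * (real ((n - 1) choose f) * ?c))"
  proof (rule sum.cong[OF refl])
    fix l assume "l \<in> {1..n}"
    then have "1 \<le> l" by simp
    from pair_count_eq[OF n this, of f "L - l"]
    show "real (l - e) * pair_count n (Suc (Suc f)) (L - l) l
        = real (l - e) * real (L - l) * (real ((n - 1) choose f) * ?c)"
      by (cases "l \<le> L") (simp_all add: of_nat_diff)
  qed
  also have "\<dots> = (\<Sum>l = 1..n. real (l - e) * real (L - l)) * (real ((n - 1) choose f) * ?c)"
    by (rule sum_distrib_right[symmetric])
  also have "\<dots> = (real t + real e) * (real t + real e - 1) * (real t + real e - 2) / 6
      * real ((n - 1) choose f) * ?c"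
  proof (cases "L \<le> n")
    case True
    have "(\<Sum>l = 1..n. real (l - e) * real (L - l))
        = (real t + real e) * (real t + real e - 1) * (real t + real e - 2) / 6"
    proof (cases s)
      case True
      then have eq: "real t = real L + 1" "e = 0" using t by (simp_all add: L_def e_def of_nat_diff)
      show ?thesis unfolding eq using sum_products(1)[OF \<open>L \<le> n\<close>] by (simp add: algebra_simps)
    next
      case False
      then have eq: "real t = real L - 1" "e = 1" using t by (simp_all add: L_def e_def of_nat_diff)
      show ?thesis unfolding eq using sum_products(2)[OF \<open>L \<le> n\<close>] by (simp add: algebra_simps)
    qed
    then show ?thesis by simp
  qed (simp add: compositions_neg)
  also have "int n - int L = int n + 1 - int t - 2 * int e"
    using t by (simp add: L_def of_nat_diff)
  finally show ?thesis .
qed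

text \<open>The recursion determines the counts, so it suffices that the closed form satisfies it.
  \<open>R\<close> is its polynomial factor. With \<open>x\<close> and \<open>y\<close> the numbers of compositions of
  \<open>n - t - 2 * e\<close> into \<open>g + 1\<close> and \<open>g\<close> parts, the recursion becomes a linear relation between
  \<open>x\<close> and \<open>y\<close>, and \<open>L\<close> is the factor by which it is a multiple of \<open>compositions_absorb\<close>.\<close>

lemma class_count_genus1_aux:
  fixes s :: bool and R L :: "real \<Rightarrow> real \<Rightarrow> real \<Rightarrow> real" and S :: "real \<Rightarrow> real"
  defines "e \<equiv> (if s then 0 else 1 :: nat)"
  assumes S: "\<And>t. S t = 2 * (t + real e) * (t + real e - 1) * (t + real e - 2)"
    and R_0: "\<And>n f. R n f 0 = 0"
    and R_1: "\<And>n. n * R (n + 1) 1 (n + 1 - 2 * real e)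
      = (n - 1) * R n 1 (n - 2 * real e) + S (n + 1 - 2 * real e)"
    and Rx: "\<And>n g t. n * R (n + 1) (g + 2) t - n * R (n + 1) (g + 2) (t + 1)
      - (n - 2 - g) * R n (g + 2) (t - 1) + (n - 2 - g) * R n (g + 2) t
      - (g + 2) * S t + (g + 2) * S (t + 1) = g * L n g t"
    and Ry: "\<And>n g t. n * R (n + 1) (g + 2) t - (g + 2) * R n (g + 1) t - (n - 2 - g) * R n (g + 2) (t - 1)
      - (g + 2) * S t = - (n - t - 2 * real e - g) * L n g t"
    and n: "1 \<le> n"
  shows "class_count s 1 n (Suc f) t = real ((n - 1) choose Suc f) * R (real n) (real f + 1) (real t) / 12
    * compositions (int n - int t - 2 * int e) f"
  using n
proof (induction n arbitrary: f t rule: dec_induct)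
  case base
  show ?case using genus_class_1(2)[of s 0] by (simp add: class_count_def)
next
  case (step n)
  consider "t = 0" | "t > Suc n" | "1 \<le> t" "t \<le> Suc n" by linarith
  then show ?case
  proof cases
    case 1
    then show ?thesis using class_count_0(2)[of "Suc n" s 1] by (simp add: R_0)
  next
    case 2
    then show ?thesis using class_count_large[of "Suc n" t] by (simp add: compositions_neg)
  next
    case 3
    define c where "c = (\<lambda>t. compositions (int n - int t - 2 * int e))"
    define F where "F = (\<lambda>t. real (n choose Suc f) * R (real n + 1) (real f + 1) (real t) / 12 * c (t - 1) f)"
    define B where "B = (\<lambda>t. real ((n - 1) choose Suc f) * R (real n) (real f + 1) (real t) / 12 * c t f)"
    \<comment> \<open>\<open>S\<close> is twelve times the cubic factor of
      \<open>merge_count_closed\<close>, so that the source shares the denominator 12 with the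
      claim.\<close>
    define M where "M = (\<lambda>t. S (real t) / 12 * real ((n - 1) choose f) * c (t - 1) f)"
    define A where "A = (\<lambda>t. class_count s 1 n f t)"
    obtain p where p: "real (n - 1 choose f) = (real f + 1) * p"
      "real (n - 1 choose Suc f) = (real n - 1 - real f) * p" "real (n choose Suc f) = real n * p"
      using binomial_triple[OF step(1), of f] .
    \<comment> \<open>For \<open>f = 0\<close> the composition number singles out
      \<open>t = n + 1 - 2 * e\<close>, so \<open>R_1\<close>, which concerns this value alone, is
      enough.\<close>
    have f0: "F t - B (t - 1) - M t = 0" if t: "1 \<le> t" and "f = 0" for t
    proof (cases "int n - int (t - 1) - 2 * int e = 0")
      case True
      then have "int t = int n + 1 - 2 * int e" using t by (simp add: of_nat_diff)
      then have "of_int (int t) = (of_int (int n + 1 - 2 * int e) :: real)" by (rule arg_cong)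
      then have rt: "real t = real n + 1 - 2 * real e" by simp
      then have rt1: "real (t - 1) = real n - 2 * real e" using t by (simp add: of_nat_diff)
      have "real ((n - 1) choose Suc 0) = real n - 1" "real ((n - 1) choose 0) = 1"
        using step(1) by (simp_all add: of_nat_diff)
      then have "12 * (F t - B (t - 1) - M t) = (real n * R (real n + 1) 1 (real n + 1 - 2 * real e)
          - (real n - 1) * R (real n) 1 (real n - 2 * real e) - S (real n + 1 - 2 * real e)) * c (t - 1) 0"
        unfolding F_def B_def M_def rt rt1 \<open>f = 0\<close> by (simp add: field_simps)
      then show ?thesis unfolding R_1 by simp
    next
      case False
      then show ?thesis using \<open>f = 0\<close> by (simp add: F_def B_def M_def c_def compositions_0_right)
    qed
    have "(\<Sum>m = t..n. A m) + B (t - 1) + M t = F t"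
    proof (rule tail_sum_unique[OF _ _ 3])
      fix t assume t: "1 \<le> t" "t \<le> n"
      show "F t - B (t - 1) - M t = F (Suc t) - B t - M (Suc t) + A t"
      proof (cases f)
        case 0
        then show ?thesis
          using f0[of t] f0[of "Suc t"] t class_count_0(1)[OF step(1)] by (simp add: A_def)
      next
        case (Suc g)
        have A: "A t = (real f + 1) * p * R (real n) (real g + 1) (real t) / 12 * c t g"
          using p(1) by (simp add: A_def Suc step.IH[unfolded One_nat_def] c_def)
        define x y where "x = c t f" and "y = c t g"
        have xy: "real g * x = (real n - real t - 2 * real e - real g) * y"
          using compositions_absorb[of g "int n - int t - 2 * int e"] by (simp add: x_def y_def c_def Suc)
        have f: "real f = real g + 1" by (simp add: Suc)
        show ?thesis
        proof (cases "g = 0 \<and> n < t + 2 * e")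
          case True
          have "x = 0" "y = 0" using True by (auto simp: x_def y_def c_def compositions_neg)
          have "c (t - 1) f = 0"
          proof (cases "n + 1 = t + 2 * e")
            case True
            then have "int n - int (t - 1) - 2 * int e = 0" using t by (simp add: of_nat_diff)
            then show ?thesis by (simp add: c_def Suc)
          next
            case False
            then have "int n - int (t - 1) - 2 * int e < 0"
              using \<open>g = 0 \<and> n < t + 2 * e\<close> t by (simp add: of_nat_diff)
            then show ?thesis by (simp add: c_def compositions_neg)
          qed
          then show ?thesis
            using \<open>x = 0\<close> \<open>y = 0\<close> by (simp add: F_def B_def M_def A x_def y_def)
        next
          case False
          have x1: "c (t - 1) f = x + y"
            using compositions_add1'[of "int n - int t - 2 * int e" g] False t
            by (auto simp: x_def y_def c_def Suc of_nat_diff algebra_simps)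
          let ?n = "real n" and ?t = "real t" and ?g = "real g"
          have F: "12 * F t = ?n * p * R (?n + 1) (?g + 2) ?t * (x + y)"
            "12 * F (Suc t) = ?n * p * R (?n + 1) (?g + 2) (?t + 1) * x"
            unfolding F_def x1 p(3) diff_Suc_1 x_def f by (simp_all add: add.assoc add.commute)
          have B: "12 * B (t - 1) = (?n - 2 - ?g) * p * R ?n (?g + 2) (?t - 1) * (x + y)"
            "12 * B t = (?n - 2 - ?g) * p * R ?n (?g + 2) ?t * x"
            using t unfolding B_def x1 p(2) x_def f by (simp_all add: of_nat_diff field_simps)
          have M: "12 * M t = (?g + 2) * p * S ?t * (x + y)" "12 * M (Suc t) = (?g + 2) * p * S (?t + 1) * x"
            unfolding M_def x1 p(1) diff_Suc_1 x_def f by (simp_all add: field_simps)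
          have A': "12 * A t = (?g + 2) * p * R ?n (?g + 1) ?t * y"
            unfolding A f y_def by (simp add: algebra_simps)
          \<comment> \<open>The coefficients of \<open>x\<close> and \<open>y\<close> are arranged
            to be the left sides of \<open>Rx\<close> and \<open>Ry\<close>.\<close>
          have "12 * (F t - B (t - 1) - M t - (F (Suc t) - B t - M (Suc t) + A t))
            = p * ((?n * R (?n + 1) (?g + 2) ?t - ?n * R (?n + 1) (?g + 2) (?t + 1)
                - (?n - 2 - ?g) * R ?n (?g + 2) (?t - 1) + (?n - 2 - ?g) * R ?n (?g + 2) ?t
                - (?g + 2) * S ?t + (?g + 2) * S (?t + 1)) * x
              + (?n * R (?n + 1) (?g + 2) ?t - (?g + 2) * R ?n (?g + 1) ?t
                - (?n - 2 - ?g) * R ?n (?g + 2) (?t - 1) - (?g + 2) * S ?t) * y)"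
            unfolding right_diff_distrib distrib_left F B M A' by (simp add: algebra_simps)
          also have "\<dots> = p * L ?n ?g ?t * (?g * x - (?n - ?t - 2 * real e - ?g) * y)"
            unfolding Rx Ry by (simp add: algebra_simps)
          finally show ?thesis using xy by simp
        qed
      qed
    next
      show "F (Suc n) = B n + M (Suc n)"
      proof (cases f)
        case 0
        then show ?thesis using f0[of "Suc n"] by simp
      next
        case (Suc g)
        have "c n f = 0" unfolding c_def Suc by (cases e) (simp_all add: compositions_neg)
        then show ?thesis by (simp add: F_def B_def M_def)
      qed
    qed
    moreover have "class_count s 1 (Suc n) (Suc f) t = (\<Sum>m = t..n. A m) + B (t - 1) + M t"
    proof -
      have ct: "int n + 1 - int t - 2 * int e = int n - int (t - 1) - 2 * int e"
        using 3(1) by (simp add: of_nat_diff)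
      have "merge_count s n (Suc (Suc f)) t = M t"
        unfolding merge_count_closed[OF step(1) 3(1), of s f, folded e_def] M_def S c_def ct by simp
      moreover have "class_count s 1 n (Suc f) (t - 1) = B (t - 1)"
        unfolding step.IH B_def c_def ..
      ultimately show ?thesis
        unfolding class_count_Suc(2)[OF step(1) 3(1)] A_def by (simp only:)
    qed
    moreover have "int (Suc n) - int t - 2 * int e = int n - int (t - 1) - 2 * int e"
      using 3(1) by (simp add: of_nat_diff)
    moreover have "real (Suc n) = real n + 1" by simp
    ultimately show ?thesis by (simp only: F_def c_def diff_Suc_1)
  qed
qed

text \<open>\<open>k\<close> is the number of cycles. The cubic is in Newton form at
  \<open>t = 1\<close> because total counts use only this value, where it collapses to
  \<open>n * k\<close>. In the proof, \<open>L\<close> is up to sign the polynomial quotient in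
  \<open>Ry\<close>.\<close>

lemma class_count_genus1:
  assumes n: "1 \<le> n"
  shows "class_count True 1 n (Suc f) t = real ((n - 1) choose Suc f)
      * (let n = real n; t = real t; k = n - 2 - real f in
          n * k + (t - 1) * k * (n - 4) + (t - 1) * (t - 2) * (3 * n - 7 * k + 3) / 2
          + (t - 1) * (t - 2) * (t - 3) * (n - k + 1) / 2) / 12
      * compositions (int n - int t) f"
proof -
  define R where "R = (\<lambda>n f t :: real. let k = n - 1 - f in
      n * k + (t - 1) * k * (n - 4) + (t - 1) * (t - 2) * (3 * n - 7 * k + 3) / 2
      + (t - 1) * (t - 2) * (t - 3) * (n - k + 1) / 2)"
  define S where "S = (\<lambda>t :: real. 2 * t * (t - 1) * (t - 2))"
  define L where "L = (\<lambda>n g t :: real. 2 + t - 3 * t\<^sup>2 + g + g * t / 2 - 3 / 2 * g * t\<^sup>2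
      + n + n * t + n * g - n\<^sup>2)"
  have "class_count True 1 n (Suc f) t = real ((n - 1) choose Suc f) * R (real n) (real f + 1) (real t) / 12
    * compositions (int n - int t - 2 * int (if True then 0 else 1)) f"
    by (rule class_count_genus1_aux[of S True R L, OF _ _ _ _ _ n])
      (simp_all add: R_def S_def L_def Let_def field_simps power2_eq_square)
  then show ?thesis by (simp add: R_def Let_def diff_diff_eq2 diff_diff_eq)
qed

text \<open>Same scheme with \<open>e = 1\<close>: a merge without back points loses two active
  points, which shifts the argument of \<open>compositions\<close> by two. At \<open>t = 1\<close>
  the cubic collapses to \<open>(n - 3) * (k - 1)\<close>.\<close>

lemma class_count_genus1_no_back_points:
  assumes n: "1 \<le> n"
  shows "class_count False 1 n (Suc f) t = real ((n - 1) choose Suc f)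
      * (let n = real n; t = real t; k = n - 2 - real f in
          (n - 3) * (k - 1) + (t - 1) * (n * k + n - 9 * k + 9) + (t - 1) * (t - 2) * (5 * n - 9 * k + 9) / 2
          + (t - 1) * (t - 2) * (t - 3) * (n - k + 1) / 2) / 12
      * compositions (int n - 2 - int t) f"
proof -
  define R where "R = (\<lambda>n f t :: real. let k = n - 1 - f in
      (n - 3) * (k - 1) + (t - 1) * (n * k + n - 9 * k + 9) + (t - 1) * (t - 2) * (5 * n - 9 * k + 9) / 2
          + (t - 1) * (t - 2) * (t - 3) * (n - k + 1) / 2)"
  define S where "S = (\<lambda>t :: real. 2 * (t + 1) * t * (t - 1))"
  define L where "L = (\<lambda>n g t :: real. 3 * n + n * t + n * g - n\<^sup>2 - 3 * t - 3 * t\<^sup>2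
      - 3 / 2 * g * t - 3 / 2 * g * t\<^sup>2)"
  have "class_count False 1 n (Suc f) t = real ((n - 1) choose Suc f) * R (real n) (real f + 1) (real t) / 12
    * compositions (int n - int t - 2 * int (if False then 0 else 1)) f"
    by (rule class_count_genus1_aux[of S False R L, OF _ _ _ _ _ n])
      (simp_all add: R_def S_def L_def Let_def field_simps power2_eq_square)
  moreover have "int n - int t - 2 * int (if False then 0 else 1) = int n - 2 - int t" by simp
  ultimately show ?thesis by (simp only: R_def Let_def) (simp add: diff_diff_eq2 diff_diff_eq)
qed

section \<open>Back points and duality\<close>

text \<open>Every cycle has exactly one point mapped to its minimum, and this point is a weak
  descent; the other weak descents are the back points. Fixed points are of the first kind.\<close>

lemma card_back_points:
  assumes p: "\<alpha> permutes {1..n}"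
  shows "card (back_points n \<alpha>) + num_cycles n \<alpha> = card (descents n \<alpha>)"
proof -
  have perm: "permutation \<alpha>" using p by (rule permutes_permutation)
  define M where "M = {i \<in> {1..n}. \<alpha> i = Min (orbit \<alpha> i)}"
  have fin: "finite (orbit \<alpha> i)" and self: "i \<in> orbit \<alpha> i" for i
    using perm by (simp_all add: finite_orbit_permutation permutation_self_in_orbit)
  have "descents n \<alpha> = back_points n \<alpha> \<union> M"
  proof (intro equalityI subsetI)
    fix i assume i: "i \<in> descents n \<alpha>"
    have "i \<in> M" if "\<alpha> i = i"
      using i that orbit_fixed_point[of \<alpha> i] by (auto simp: M_def descents_def)
    then show "i \<in> back_points n \<alpha> \<union> M"
      using i by (fastforce simp: back_points_def descents_def M_def)
  next
    fix i assume "i \<in> back_points n \<alpha> \<union> M"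
    moreover have "Min (orbit \<alpha> i) \<le> i" using fin self by simp
    ultimately show "i \<in> descents n \<alpha>" by (auto simp: back_points_def descents_def M_def)
  qed
  moreover have "back_points n \<alpha> \<inter> M = {}" by (auto simp: back_points_def M_def)
  moreover have "finite M" "finite (back_points n \<alpha>)" by (auto simp: M_def back_points_def)
  moreover have "num_cycles n \<alpha> = card M"
  proof -
    have "inj_on (orbit \<alpha>) M"
    proof (rule inj_onI)
      fix i j assume "i \<in> M" "j \<in> M" "orbit \<alpha> i = orbit \<alpha> j"
      then have "\<alpha> i = \<alpha> j" by (simp add: M_def)
      then show "i = j" using permutes_inj[OF p] by (simp add: inj_eq)
    qed
    moreover have "orbit \<alpha> ` M = orbit \<alpha> ` {1..n}"
    proof (intro equalityI subsetI)
      fix C assume "C \<in> orbit \<alpha> ` {1..n}"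
      then obtain x where x: "x \<in> {1..n}" "C = orbit \<alpha> x" by auto
      define i where "i = inv \<alpha> (Min C)"
      have ai: "\<alpha> i = Min C" using permutes_inverses(1)[OF p] by (simp add: i_def)
      have "Min C \<in> C" using fin self x by (metis Min_in empty_iff)
      then have "orbit \<alpha> (\<alpha> i) = C" unfolding ai x(2) orbit_eq_iff[OF perm] .
      then have C: "orbit \<alpha> i = C" using permutation_orbit_step[OF perm] by simp
      moreover have "i \<in> {1..n}" using C self[of i] orbit_subset_carrier[OF p x(1)] x(2) by blast
      ultimately show "C \<in> orbit \<alpha> ` M" using ai by (force simp: M_def)
    qed (auto simp: M_def)
    ultimately show ?thesis unfolding num_cycles_def by (metis card_image)
  qed
  ultimately show ?thesis by (simp add: card_Un_disjoint)
qed

text \<open>In genus one the numbers of cycles and faces add up to \<open>n - 1\<close>. The guard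
  is there because natural subtraction truncates.\<close>

lemma genus1_perms_eq:
  "genus1_perms n k = (if k + 1 \<le> n then genus_class True 1 n (n - 1 - k) else {})"
  by (auto simp: genus1_perms_def has_genus_def genus_class_def num_cycles_dual[symmetric] dual_def)

lemma genus1_perms_iff:
  assumes "\<alpha> permutes {1..n}"
  shows "\<alpha> \<in> genus1_perms n k \<longleftrightarrow> num_cycles n \<alpha> = k \<and> num_cycles n (dual n \<alpha>) + k + 1 = n"
  using assms by (auto simp: genus1_perms_def has_genus_def dual_def)

text \<open>The recursion at \<open>t = 1\<close> sums over all sizes; its fixed-point term has size
  0 and vanishes, and so does the merge cubic. Thus the total is a single value of the closed
  form.\<close>

lemma card_genus_class:
  assumes n: "1 \<le> n"
  shows "real (card (genus_class s 1 n f)) = class_count s 1 (Suc n) (Suc f) 1"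
proof -
  have "(\<Sum>m = 1..n. class_count s 1 n f m) = (\<Sum>\<alpha>\<in>genus_class s 1 n f. \<Sum>m = 1..n. if card (active s n \<alpha>) = m then 1 else 0)"
    unfolding class_count_def by (rule sum.swap)
  also have "\<dots> = (\<Sum>\<alpha>\<in>genus_class s 1 n f. 1)"
  proof (rule sum.cong[OF refl])
    fix \<alpha> assume "\<alpha> \<in> genus_class s 1 n f"
    note a = genus_class_permutes[OF this]
    have "n \<in> active s n \<alpha>"
      using last_face_self[OF n a] permutes_in_image[OF a, of n] n by (simp add: active_def)
    then have "1 \<le> card (active s n \<alpha>)"
      using finite_active[OF n a, of s] by (metis One_nat_def Suc_leI card_gt_0_iff empty_iff)
    then show "(\<Sum>m = 1..n. if card (active s n \<alpha>) = m then 1 else 0) = (1 :: real)"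
      using card_active_le[OF n a, of s] by simp
  qed
  finally have "(\<Sum>m = 1..n. class_count s 1 n f m) = real (card (genus_class s 1 n f))" by simp
  moreover have "merge_count s n (Suc (Suc f)) 1 = 0"
    using merge_count_closed[OF n, of 1 s f] by (cases s) simp_all
  ultimately show ?thesis
    using class_count_Suc(2)[OF n, of 1 s f] class_count_0(2)[OF n, of s 1 "Suc f"] by simp
qed

section \<open>From class counts to binomial formulas\<close>

lemma ibinom_nat: "ibinom (int m) (int r) = real (m choose r)"
  by (simp add: ibinom_def)

lemma ibinom_neg: "r < 0 \<Longrightarrow> ibinom m r = 0"
  by (simp add: ibinom_def)

lemma ibinom_large: "m < r \<Longrightarrow> ibinom m r = 0"
  by (simp add: ibinom_def)

lemma ibinom_2: "ibinom (int n) 2 = real n * (real n - 1) / 2"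
proof -
  have "real (n choose 2) = real n * (real n - 1) / 2"
    by (induction n) (simp_all add: numeral_2_eq_2 field_simps)
  then show ?thesis using ibinom_nat[of n 2] by simp
qed

lemma binomial_absorb_real: "real (Suc k) * real (Suc m choose Suc k) = real (Suc m) * real (m choose k)"
  by (metis Suc_times_binomial of_nat_mult)

lemma compositions_Suc: "compositions (int (Suc m)) (Suc f) = real (m choose f)"
  by (simp add: compositions_def nat_add_distrib)

lemma card_genus1:
  assumes n: "1 \<le> n" and k: "1 \<le> k"
  shows "real (card (genus1_perms n k))
    = 1/6 * ibinom (int n + 1) 2 * ibinom (int n - 1) (int k + 1) * ibinom (int n - 1) (int k - 1)"
proof (cases "k + 2 \<le> n")
  case True
  then obtain f where f: "n = k + 2 + f" using le_Suc_ex by blast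
  have sub: "n - 1 - k = Suc f" using f by simp
  have "real (card (genus1_perms n k)) = class_count True 1 (Suc n) (Suc (Suc f)) 1"
    using card_genus_class[OF n, of True "Suc f"] f sub by (simp add: genus1_perms_eq)
  also have "\<dots> = real (n choose Suc (Suc f)) * ((real n + 1) * real k) / 12 * compositions (int n) (Suc f)"
    using class_count_genus1[of "Suc n" "Suc f" 1] f by (simp add: Let_def)
  also have "compositions (int n) (Suc f) = real ((n - 1) choose (k + 1))"
  proof -
    have "int n = int (Suc (k + 1 + f))" "n - 1 = k + 1 + f" using f by simp_all
    then show ?thesis
      using compositions_Suc[of "k + 1 + f" f] binomial_symmetric[of f "k + 1 + f"] by simp
  qed
  also have "n choose Suc (Suc f) = n choose k"
    using binomial_symmetric[of k n] f by simp
  finally have *: "real (card (genus1_perms n k)) = (real n + 1) * (real k * real (n choose k)) / 12 * real ((n - 1) choose (k + 1))"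
    by simp
  have "real k * real (n choose k) = real n * real ((n - 1) choose (k - 1))"
    using binomial_absorb_real[of "k - 1" "n - 1"] n k by simp
  moreover have "ibinom (int n - 1) (int k + 1) = real ((n - 1) choose (k + 1))"
    "ibinom (int n - 1) (int k - 1) = real ((n - 1) choose (k - 1))"
    using ibinom_nat[of "n - 1" "k + 1"] ibinom_nat[of "n - 1" "k - 1"] n k by (simp_all add: of_nat_diff add.commute)
  moreover have "ibinom (int n + 1) 2 = (real n + 1) * real n / 2"
    using ibinom_2[of "Suc n"] by (simp add: add.commute)
  ultimately show ?thesis unfolding * by simp
next
  case False
  \<comment> \<open>For \<open>k + 1 = n\<close> there would be no face at all, which is
    impossible.\<close>
  then have "genus1_perms n k = {}"
    using genus_class_0_faces[OF n] by (auto simp: genus1_perms_eq)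
  then show ?thesis using False by (simp add: ibinom_large)
qed

definition no_back_count :: "nat \<Rightarrow> nat \<Rightarrow> nat" where
  "no_back_count n k = card {\<alpha> \<in> genus1_perms n k. card (descents n \<alpha>) = num_cycles n \<alpha>}"

lemma no_back_count_eq_class:
  "no_back_count n k = (if k + 1 \<le> n then card (genus_class False 1 n (n - 1 - k)) else 0)"
proof -
  have "{\<alpha> \<in> genus_class True 1 n f. card (descents n \<alpha>) = num_cycles n \<alpha>} = genus_class False 1 n f" for f
    by (auto simp: genus_class_def)
  then show ?thesis by (simp add: no_back_count_def genus1_perms_eq)
qed

lemma no_back_count_eq:
  assumes n: "1 \<le> n" and k: "1 \<le> k"
  shows "real (no_back_count n k)
    = 1/6 * ibinom (int n) 2 * ibinom (int n - 2) (int k) * ibinom (int n - 2) (int k - 2)"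
proof (cases "k + 2 \<le> n")
  case True
  then obtain f where f: "n = k + 2 + f" using le_Suc_ex by blast
  have sub: "n - 1 - k = Suc f" using f by simp
  have "real (no_back_count n k) = class_count False 1 (Suc n) (Suc (Suc f)) 1"
    using card_genus_class[OF n, of False "Suc f"] f sub by (simp add: no_back_count_eq_class)
  also have "\<dots> = real (n choose Suc (Suc f)) * ((real n - 2) * (real k - 1)) / 12 * compositions (int n - 2) (Suc f)"
    using class_count_genus1_no_back_points[of "Suc n" "Suc f" 1] f by (simp add: Let_def)
  also have "compositions (int n - 2) (Suc f) = real ((n - 3) choose (k - 1))"
  proof -
    have "int n - 2 = int (Suc (k - 1 + f))" "n - 3 = k - 1 + f" using f k by simp_all
    then show ?thesis
      using compositions_Suc[of "k - 1 + f" f] binomial_symmetric[of f "k - 1 + f"] by simp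
  qed
  also have "n choose Suc (Suc f) = n choose k"
    using binomial_symmetric[of k n] f by simp
  finally have *: "real (no_back_count n k)
      = (real k - 1) * real (n choose k) / 12 * ((real n - 2) * real ((n - 3) choose (k - 1)))"
    by simp
  show ?thesis
  proof (cases "k = 1")
    \<comment> \<open>Both sides vanish: the left through the factor \<open>k - 1\<close>, the right
      because the lower index \<open>k - 2\<close> is negative.\<close>
    case True
    then show ?thesis unfolding * by (simp add: ibinom_neg)
  next
    case False
    then obtain j where j: "k = Suc (Suc j)" using k by (metis One_nat_def Suc_le_D not_less_eq_eq le_antisym)
    then obtain m where m: "n = Suc (Suc (Suc m))" using f by auto
    have W: "(real n - 2) * real ((n - 3) choose (k - 1)) = real k * real ((n - 2) choose k)"
      using binomial_absorb_real[of "Suc j" m] by (simp add: j m)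
    have V: "(real k - 1) * (real k * real (n choose k)) = real n * (real n - 1) * real ((n - 2) choose (k - 2))"
    proof -
      have "(real k - 1) * (real k * real (n choose k)) = (real k - 1) * (real n * real ((n - 1) choose (k - 1)))"
        using binomial_absorb_real[of "Suc j" "Suc (Suc m)"] by (simp add: j m)
      also have "\<dots> = real n * ((real k - 1) * real ((n - 1) choose (k - 1)))" by simp
      also have "(real k - 1) * real ((n - 1) choose (k - 1)) = (real n - 1) * real ((n - 2) choose (k - 2))"
        using binomial_absorb_real[of "j" "Suc m"] by (simp add: j m)
      finally show ?thesis by simp
    qed
    have "real (no_back_count n k) = (real k - 1) * (real k * real (n choose k)) / 12 * real ((n - 2) choose k)"
      unfolding * W by simp
    also note V
    finally have "real (no_back_count n k)
      = real n * (real n - 1) * real ((n - 2) choose (k - 2)) / 12 * real ((n - 2) choose k)" .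
    moreover have "ibinom (int n - 2) (int k) = real ((n - 2) choose k)"
      "ibinom (int n - 2) (int k - 2) = real ((n - 2) choose (k - 2))"
      using ibinom_nat[of "n - 2" k] ibinom_nat[of "n - 2" "k - 2"] j m by simp_all
    ultimately show ?thesis by (simp add: ibinom_2)
  qed
next
  case False
  then have "no_back_count n k = 0"
    using genus_class_0_faces[OF n] by (auto simp: no_back_count_eq_class)
  then show ?thesis using False by (simp add: ibinom_large)
qed

text \<open>The dual of the dual is a conjugate of \<open>\<alpha>\<close>, so its cycles are the
  images of the cycles of \<open>\<alpha>\<close> under \<open>inv (zeta n)\<close>.\<close>

lemma num_cycles_dual_dual:
  assumes n: "1 \<le> n" and p: "\<alpha> permutes {1..n}"
  shows "card (faces n (dual n \<alpha>)) = num_cycles n \<alpha>"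
proof -
  note z = zeta_permutes[OF n]
  have perm: "permutation \<alpha>" using p by (rule permutes_permutation)
  have "dual n (dual n \<alpha>) = inv (zeta n) \<circ> \<alpha> \<circ> zeta n"
    unfolding dual_def using permutes_bij[OF z] permutes_bij[OF permutes_inv[OF p]]
    by (simp add: o_inv_distrib permutes_inv_inv[OF p] o_assoc)
  then have eq: "dual n (dual n \<alpha>) (inv (zeta n) x) = inv (zeta n) (\<alpha> x)" for x
    using permutes_inverses(1)[OF z] by simp
  have orb: "orbit (dual n (dual n \<alpha>)) (inv (zeta n) x) = inv (zeta n) ` orbit \<alpha> x" for x
    by (rule orbit_inverse[symmetric]) (use eq permutation_self_in_orbit[OF perm] in auto)
  have "inv (zeta n) ` {1..n} = {1..n}"
    using permutes_image[OF permutes_inv[OF z]] .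
  then have "faces n (dual n \<alpha>) = orbit (dual n (dual n \<alpha>)) ` (inv (zeta n) ` {1..n})"
    by (simp add: faces_def)
  also have "\<dots> = (\<lambda>C. inv (zeta n) ` C) ` (orbit \<alpha> ` {1..n})"
    by (simp add: image_image orb)
  also have "card \<dots> = card (orbit \<alpha> ` {1..n})"
    using permutes_inj[OF permutes_inv[OF z]]
    by (intro card_image) (auto intro!: inj_onI simp: inj_image_eq_iff)
  finally show ?thesis by (simp add: num_cycles_def)
qed

lemma bij_betw_dual:
  assumes n: "1 \<le> n"
  shows "bij_betw (dual n) {\<alpha>. \<alpha> permutes {1..n}} {\<alpha>. \<alpha> permutes {1..n}}"
proof (rule bij_betwI)
  note z = zeta_permutes[OF n]
  show "dual n \<in> {\<alpha>. \<alpha> permutes {1..n}} \<rightarrow> {\<alpha>. \<alpha> permutes {1..n}}"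
    using dual_permutes[OF n] by simp
  show "(\<lambda>\<gamma>. zeta n \<circ> inv \<gamma>) \<in> {\<alpha>. \<alpha> permutes {1..n}} \<rightarrow> {\<alpha>. \<alpha> permutes {1..n}}"
    using permutes_compose[OF permutes_inv z] by simp
  show "zeta n \<circ> inv (dual n \<alpha>) = \<alpha>" if "\<alpha> \<in> {\<alpha>. \<alpha> permutes {1..n}}" for \<alpha>
  proof -
    have p: "\<alpha> permutes {1..n}" using that by simp
    have "inv (dual n \<alpha>) = inv (zeta n) \<circ> \<alpha>"
      unfolding dual_def using permutes_bij[OF z] permutes_bij[OF permutes_inv[OF p]]
      by (simp add: o_inv_distrib permutes_inv_inv[OF p])
    then show ?thesis using permutes_inv_o(1)[OF z] by (simp add: o_assoc)
  qed
  show "dual n (zeta n \<circ> inv \<gamma>) = \<gamma>" if "\<gamma> \<in> {\<alpha>. \<alpha> permutes {1..n}}" for \<gamma>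
  proof -
    have p: "\<gamma> permutes {1..n}" using that by simp
    have "inv (zeta n \<circ> inv \<gamma>) = \<gamma> \<circ> inv (zeta n)"
      using permutes_bij[OF z] permutes_bij[OF permutes_inv[OF p]]
      by (simp add: o_inv_distrib permutes_inv_inv[OF p])
    then show ?thesis using permutes_inv_o(2)[OF z] by (simp add: dual_def comp_assoc)
  qed
qed

lemma genus1_back_points_dual:
  assumes n: "1 \<le> n" and \<alpha>: "\<alpha> \<in> genus1_perms n k"
  shows "card (back_points n \<alpha>) + card (back_points n (dual n \<alpha>)) = 2"
proof -
  have p: "\<alpha> permutes {1..n}" using \<alpha> by (simp add: genus1_perms_def)
  have "num_cycles n \<alpha> + num_cycles n (dual n \<alpha>) + 2 = Suc n"
    using \<alpha> by (auto simp: genus1_perms_def has_genus_def dual_def)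
  then show ?thesis
    using card_back_points[OF p] card_back_points[OF dual_permutes[OF n p]] card_descents_dual[OF n p]
    by linarith
qed

lemma p_back_0: "p_back 0 n k = no_back_count n k"
proof -
  have "card (back_points n \<alpha>) = 0 \<longleftrightarrow> card (descents n \<alpha>) = num_cycles n \<alpha>" if "\<alpha> \<in> genus1_perms n k" for \<alpha>
    using that card_back_points[of \<alpha> n] by (auto simp: genus1_perms_def)
  then show ?thesis
    unfolding p_back_def no_back_count_def by (intro arg_cong[of _ _ card]) auto
qed

lemma p_back_2:
  assumes n: "1 \<le> n" and k: "k + 1 \<le> n"
  shows "p_back 2 n k = p_back 0 n (n - 1 - k)"
proof -
  let ?A = "{\<alpha> \<in> genus1_perms n k. card (back_points n \<alpha>) = 2}"
  let ?B = "{\<alpha> \<in> genus1_perms n (n - 1 - k). card (back_points n \<alpha>) = 0}"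
  have iff: "\<alpha> \<in> ?A \<longleftrightarrow> dual n \<alpha> \<in> ?B" if p: "\<alpha> permutes {1..n}" for \<alpha>
  proof -
    have "\<alpha> \<in> genus1_perms n k \<longleftrightarrow> dual n \<alpha> \<in> genus1_perms n (n - 1 - k)"
      unfolding genus1_perms_iff[OF p] genus1_perms_iff[OF dual_permutes[OF n p]]
        num_cycles_dual[of n "dual n \<alpha>"] num_cycles_dual_dual[OF n p]
      using k by linarith
    then show ?thesis using genus1_back_points_dual[OF n, of \<alpha> k] by auto
  qed
  have "bij_betw (dual n) ?A ?B"
  proof (rule bij_betw_imageI)
    show "inj_on (dual n) ?A"
      using bij_betw_dual[OF n] by (auto simp: bij_betw_def genus1_perms_def intro: inj_on_subset)
    show "dual n ` ?A = ?B"
    proof (intro equalityI subsetI)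
      fix \<gamma> assume "\<gamma> \<in> dual n ` ?A"
      then obtain \<alpha> where *: "\<gamma> = dual n \<alpha>" "\<alpha> \<in> ?A" by blast
      then have "\<alpha> permutes {1..n}" by (simp add: genus1_perms_def)
      from iffD1[OF iff[OF this] *(2)] show "\<gamma> \<in> ?B" by (simp only: *(1))
    next
      fix \<gamma> assume \<gamma>: "\<gamma> \<in> ?B"
      then have "\<gamma> \<in> dual n ` {\<alpha>. \<alpha> permutes {1..n}}"
        using bij_betw_dual[OF n] by (simp add: bij_betw_def genus1_perms_def)
      then obtain \<alpha> where *: "\<gamma> = dual n \<alpha>" "\<alpha> permutes {1..n}" by blast
      then have "\<alpha> \<in> ?A" using \<gamma> iffD2[OF iff[OF *(2)]] by (simp only: *(1))
      then show "\<gamma> \<in> dual n ` ?A" unfolding *(1) by (rule imageI)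
    qed
  qed
  then show ?thesis unfolding p_back_def by (rule bij_betw_same_card)
qed

lemma p_star_eq_sum:
  assumes n: "1 \<le> n"
  shows "p_star n k = p_back 0 n k + p_back 1 n k + p_back 2 n k"
proof -
  let ?A = "\<lambda>j. {\<alpha> \<in> genus1_perms n k. card (back_points n \<alpha>) = j}"
  have fin: "finite (genus1_perms n k)" by (simp add: genus1_perms_eq)
  have "genus1_perms n k = ?A 0 \<union> ?A 1 \<union> ?A 2"
    using genus1_back_points_dual[OF n] by fastforce
  then have "p_star n k = card (?A 0 \<union> ?A 1 \<union> ?A 2)" by (simp add: p_star_def)
  also have "\<dots> = card (?A 0 \<union> ?A 1) + card (?A 2)"
    using fin by (intro card_Un_disjoint) auto
  also have "card (?A 0 \<union> ?A 1) = card (?A 0) + card (?A 1)"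
    using fin by (intro card_Un_disjoint) auto
  finally show ?thesis by (simp add: p_back_def)
qed

lemma p_back_2_eq:
  assumes n: "1 \<le> n" and k: "1 \<le> k"
  shows "real (p_back 2 n k)
    = 1/6 * ibinom (int n) 2 * ibinom (int n - 2) (int k + 1) * ibinom (int n - 2) (int k - 1)"
proof (cases "k + 2 \<le> n")
  case True
  define f where "f = n - 1 - k"
  have f: "1 \<le> f" "n = k + f + 1" using True by (auto simp: f_def)
  have *: "real (p_back 2 n k) = 1/6 * ibinom (int n) 2 * ibinom (int n - 2) (int f) * ibinom (int n - 2) (int f - 2)"
    using p_back_2[OF n, of k] p_back_0[of n f] no_back_count_eq[OF n f(1)] True by (simp add: f_def)
  \<comment> \<open>As \<open>n - 2 = k - 1 + f\<close>, reflection turns the lower indices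
    \<open>f\<close> and \<open>f - 2\<close> into \<open>k - 1\<close> and
    \<open>k + 1\<close>.\<close>
  have sym: "ibinom m r = ibinom m (m - r)" if "0 \<le> m" for m r
    using that binomial_symmetric[of "nat r" "nat m"]
    by (auto simp: ibinom_def nat_diff_distrib)
  have "ibinom (int n - 2) (int f) = ibinom (int n - 2) (int k - 1)"
    "ibinom (int n - 2) (int f - 2) = ibinom (int n - 2) (int k + 1)"
    using sym[of "int n - 2" "int f"] sym[of "int n - 2" "int f - 2"] f by simp_all
  then show ?thesis unfolding * by simp
next
  case False
  then have "genus1_perms n k = {}"
    using genus_class_0_faces[OF n] by (auto simp: genus1_perms_eq)
  then show ?thesis using False by (simp add: p_back_def ibinom_large)
qed

text \<open>The products on the right belong to no, two and one back points, in this order. The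
  identity makes the closed forms add up to the total, so that subtraction yields the count for one
  back point.\<close>

lemma ibinom_identity:
  assumes n: "1 \<le> n" and k: "1 \<le> k"
  defines "B \<equiv> \<lambda>i. ibinom (int n - 2) (int k + i)"
  shows "ibinom (int n + 1) 2 * ibinom (int n - 1) (int k + 1) * ibinom (int n - 1) (int k - 1)
    = ibinom (int n) 2 * (B 0 * B (-2) + B 1 * B (-1) + 2 * B 0 * B (-1))"
proof (cases "k + 2 \<le> n")
  case False
  then show ?thesis by (simp add: B_def ibinom_large)
next
  case True
  define N where "N = n - 2"
  have N: "n = N + 2" "k \<le> N" using True by (auto simp: N_def)
  obtain j where j: "k = Suc j" using k by (cases k) auto
  define b where "b = real (N choose j)"
  have B0: "B 0 = real (N choose k)" "B 1 = real (N choose Suc k)" "B (-1) = b"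
    using ibinom_nat[of N k] ibinom_nat[of N "Suc k"] ibinom_nat[of N j] by (simp_all add: B_def N j b_def add.commute)
  have S: "real (Suc i) * real (N choose Suc i) = (real N - real i) * real (N choose i)" for i
  proof -
    obtain p where "real (N choose i) = (real i + 1) * p" "real (N choose Suc i) = (real N - real i) * p"
      using binomial_triple[of "Suc N" i] by auto
    then show ?thesis by simp
  qed
  have c: "real k * B 0 = (real N - real k + 1) * b"
    using S[of j] by (simp add: B0 b_def j algebra_simps)
  have d: "(real k + 1) * B 1 = (real N - real k) * B 0"
    using S[of k] by (simp add: B0 algebra_simps)
  have a: "(real N - real k + 2) * B (-2) = (real k - 1) * b"
    and P2: "ibinom (int n - 1) (int k - 1) = b + B (-2)"
  proof -
    have "(real N - real k + 2) * B (-2) = (real k - 1) * b \<and> ibinom (int n - 1) (int k - 1) = b + B (-2)"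
    \<comment> \<open>\<open>j = 0\<close> is treated apart: there \<open>B (-2)\<close> has a
      negative lower index and is 0 by convention.\<close>
    proof (cases j)
      case 0
      then show ?thesis using ibinom_nat[of "Suc N" 0] by (simp add: B_def N j ibinom_neg b_def add.commute)
    next
      case (Suc i)
      have "B (-2) = real (N choose i)" using ibinom_nat[of N i] by (simp add: B_def N j Suc)
      then show ?thesis using S[of i] ibinom_nat[of "Suc N" "Suc i"]
        by (simp add: b_def j Suc N algebra_simps)
    qed
    then show "(real N - real k + 2) * B (-2) = (real k - 1) * b" "ibinom (int n - 1) (int k - 1) = b + B (-2)" by auto
  qed
  have P1: "ibinom (int n - 1) (int k + 1) = B 0 + B 1"
    using ibinom_nat[of "Suc N" "Suc k"] by (simp add: B0 N add.commute)
  have nz: "real N - real k + 2 \<noteq> 0" "real k \<noteq> 0" "real k + 1 \<noteq> 0" using N k by auto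
  \<comment> \<open>All neighbours become rational multiples of \<open>b\<close>, with nonzero
    denominators since \<open>k \<le> N\<close>; the rest is an identity of rational
    functions.\<close>
  have eqs: "B (-2) = (real k - 1) / (real N - real k + 2) * b" "B 0 = (real N - real k + 1) / real k * b"
    "B 1 = (real N - real k) / (real k + 1) * B 0"
    using a c d nz by (simp_all add: field_simps)
  have main: "(real N + 3) * (B 0 + B 1) * (b + B (-2)) = (real N + 1) * (B 0 * B (-2) + B 1 * b + 2 * B 0 * b)"
    unfolding eqs(3) eqs(1,2) using nz by (simp add: divide_simps) (simp add: algebra_simps)
  have i1: "ibinom (int n + 1) 2 = (real N + 2) / 2 * (real N + 3)"
    using ibinom_2[of "Suc n"] by (simp add: N algebra_simps)
  have "ibinom (int n + 1) 2 * ibinom (int n - 1) (int k + 1) * ibinom (int n - 1) (int k - 1)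
      = (real N + 2) / 2 * ((real N + 3) * (B 0 + B 1) * (b + B (-2)))"
    unfolding P1 P2 i1 by (simp only: mult.assoc)
  also note main
  also have "(real N + 2) / 2 * ((real N + 1) * (B 0 * B (-2) + B 1 * b + 2 * B 0 * b))
      = (real N + 2) / 2 * (real N + 1) * (B 0 * B (-2) + B 1 * b + 2 * B 0 * b)" by simp
  also have "(real N + 2) / 2 * (real N + 1) = ibinom (int n) 2"
    using ibinom_2[of n] by (simp add: N algebra_simps)
  finally show ?thesis unfolding B0(3) .
qed

lemma p_back_1_eq:
  assumes n: "1 \<le> n" and k: "1 \<le> k"
  shows "real (p_back 1 n k)
    = 1/3 * ibinom (int n) 2 * ibinom (int n - 2) (int k) * ibinom (int n - 2) (int k - 1)"
proof -
  have "real (p_back 1 n k) = real (p_star n k) - real (p_back 0 n k) - real (p_back 2 n k)"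
    by (simp add: p_star_eq_sum[OF n])
  then show ?thesis
    using card_genus1[OF n k] no_back_count_eq[OF n k] p_back_2_eq[OF n k] ibinom_identity[OF n k]
    by (simp add: p_star_def p_back_0 algebra_simps)
qed

section \<open>Partitions\<close>

text \<open>Without back points, iterating \<open>\<alpha>\<close> from the minimum of a cycle lists the cycle
  in increasing order.\<close>

lemma sorted_list_of_orbit:
  assumes p: "\<alpha> permutes {1..n}" and nb: "back_points n \<alpha> = {}" and C: "C \<in> orbit \<alpha> ` {1..n}"
  shows "sorted_list_of_set C = support \<alpha> (Min C)"
proof -
  define m where "m = Min C"
  have perm: "permutation \<alpha>" using p by (rule permutes_permutation)
  obtain x where x: "x \<in> {1..n}" "C = orbit \<alpha> x" using C by auto
  have sub: "C \<subseteq> {1..n}" using orbit_subset_carrier[OF p x(1)] x(2) by simp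
  have fin: "finite C" using sub by (rule finite_subset) simp
  have "C \<noteq> {}" using x orbit_nonempty by simp
  then have mC: "m \<in> C" using fin by (simp add: m_def)
  then have Cm: "C = orbit \<alpha> m" using x(2) orbit_eq_iff[OF perm, of m x] by simp
  have set_supp: "set (support \<alpha> m) = C"
    unfolding support_set[OF perm] Cm orbit_altdef_permutation[OF perm] by auto
  \<comment> \<open>A weak descent before the cycle closes would be a back point, since the walk
    from the minimum \<open>m\<close> does not return to \<open>m\<close> before time
    \<open>least_power \<alpha> m\<close>.\<close>
  have "(\<alpha> ^^ i) m < (\<alpha> ^^ Suc i) m" if i: "Suc i < least_power \<alpha> m" for i
  proof (rule ccontr)
    let ?y = "(\<alpha> ^^ i) m"
    assume "\<not> ?y < (\<alpha> ^^ Suc i) m"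
    then have le: "\<alpha> ?y \<le> ?y" by simp
    have yC: "?y \<in> C" using i set_supp by auto
    then have y: "?y \<in> {1..n}" "orbit \<alpha> ?y = C"
      using sub Cm orbit_eq_iff[OF perm, of ?y m] by auto
    have ne: "\<alpha> ?y \<noteq> m"
    proof
      assume "\<alpha> ?y = m"
      then have "(\<alpha> ^^ Suc i) m = m" by simp
      then have "least_power \<alpha> m \<le> Suc i" by (rule least_power_le) simp
      then show False using i by simp
    qed
    have "\<alpha> ?y \<noteq> ?y"
    proof
      assume "\<alpha> ?y = ?y"
      then have "C = {?y}" using y(2) orbit_eq_singleton_iff[of \<alpha> ?y] by simp
      then show False using ne \<open>\<alpha> ?y = ?y\<close> mC by simp
    qed
    then have "?y \<in> back_points n \<alpha>"
      using le ne y by (simp add: back_points_def m_def)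
    then show False using nb by simp
  qed
  then have "sorted_wrt (<) (support \<alpha> m)"
    by (subst sorted_wrt_iff_nth_Suc_transp) auto
  then have "sorted (support \<alpha> m)" "distinct (support \<alpha> m)" by (simp_all only: strict_sorted_iff)
  then have "sorted_list_of_set (set (support \<alpha> m)) = support \<alpha> m"
    by (rule sorted_list_of_set.idem_if_sorted_distinct)
  then have "sorted_list_of_set C = support \<alpha> m" by (simp only: set_supp)
  then show ?thesis by (simp only: m_def)
qed

lemma partition_on_orbits:
  fixes n :: nat
  assumes p: "\<alpha> permutes {1..n}"
  shows "partition_on {1..n} (orbit \<alpha> ` {1..n})"
proof (rule partition_onI)
  have perm: "permutation \<alpha>" using p by (rule permutes_permutation)
  show "\<Union> (orbit \<alpha> ` {1..n}) = {1..n}"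
    using orbit_subset_carrier[OF p] permutation_self_in_orbit[OF perm] by blast
  show "disjnt C D" if "C \<in> orbit \<alpha> ` {1..n}" "D \<in> orbit \<alpha> ` {1..n}" "C \<noteq> D" for C D
    using that orbit_eq_or_disjoint[OF perm] unfolding disjnt_def by blast
  show "{} \<notin> orbit \<alpha> ` {1..n}"
    using orbit_nonempty[of \<alpha>] by (metis imageE)
qed

lemma partition_perm_apply:
  assumes P: "partition_on A P" and B: "B \<in> P" "x \<in> B"
  shows "partition_perm P x = cycle_of_list (sorted_list_of_set B) x"
proof -
  have "(THE C. C \<in> P \<and> x \<in> C) = B"
    using partition_onD2[OF P] B by (intro the_equality) (auto dest: disjointD)
  then show ?thesis using B by (auto simp: partition_perm_def)
qed

text \<open>By \<open>sorted_list_of_orbit\<close> the increasing list of a cycle is its traversal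
  by \<open>\<alpha>\<close>, so the cyclic shift along this list is \<open>\<alpha>\<close>
  again.\<close>

lemma partition_perm_orbits:
  assumes p: "\<alpha> permutes {1..n}" and nb: "back_points n \<alpha> = {}"
  shows "partition_perm (orbit \<alpha> ` {1..n}) = \<alpha>"
proof
  fix x
  note P = partition_on_orbits[OF p]
  have perm: "permutation \<alpha>" using p by (rule permutes_permutation)
  show "partition_perm (orbit \<alpha> ` {1..n}) x = \<alpha> x"
  proof (cases "x \<in> {1..n}")
    case True
    define C where "C = orbit \<alpha> x"
    have C: "C \<in> orbit \<alpha> ` {1..n}" "x \<in> C"
      using True permutation_self_in_orbit[OF perm] by (auto simp: C_def)
    have "finite C" using perm by (simp add: C_def finite_orbit_permutation)
    then have "x \<in> set (support \<alpha> (Min C))"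
      using sorted_list_of_orbit[OF p nb C(1)] C(2) by (metis set_sorted_list_of_set)
    from cycle_restrict[OF perm this]
    show ?thesis
      unfolding partition_perm_apply[OF P C] sorted_list_of_orbit[OF p nb C(1)] ..
  next
    case False
    then have "x \<notin> \<Union> (orbit \<alpha> ` {1..n})" unfolding partition_onD1[OF P, symmetric] .
    then show ?thesis
      unfolding partition_perm_def using permutes_not_in[OF p False] by (simp only: if_False)
  qed
qed

context
  fixes n :: nat and P :: "nat set set"
  assumes P: "partition_on {1..n} P"
begin

private lemma block: "B \<in> P \<Longrightarrow> B \<subseteq> {1..n}" "B \<in> P \<Longrightarrow> B \<noteq> {}" "B \<in> P \<Longrightarrow> finite B"
proof -
  show "B \<in> P \<Longrightarrow> B \<subseteq> {1..n}" using partition_onD1[OF P] by auto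
  then show "B \<in> P \<Longrightarrow> finite B" by (meson finite_atLeastAtMost finite_subset)
  show "B \<in> P \<Longrightarrow> B \<noteq> {}" using partition_onD3[OF P] by auto
qed

private lemma image_block:
  assumes "B \<in> P" shows "partition_perm P ` B = B"
proof -
  have "partition_perm P ` B = cycle_of_list (sorted_list_of_set B) ` B"
    using partition_perm_apply[OF P assms] by (intro image_cong) auto
  also have "\<dots> = B"
    using permutes_image[OF cycle_permutes[of "sorted_list_of_set B"]] block(3)[OF assms] by simp
  finally show ?thesis .
qed

lemma partition_perm_permutes: "partition_perm P permutes {1..n}"
proof (rule bij_imp_permutes)
  have "partition_perm P ` \<Union>P = \<Union>P" using image_block by blast
  then have img: "partition_perm P ` {1..n} = {1..n}" using partition_onD1[OF P] by simp
  then have "inj_on (partition_perm P) {1..n}" by (intro eq_card_imp_inj_on) simp_all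
  then show "bij_betw (partition_perm P) {1..n} {1..n}" using img by (simp add: bij_betw_def)
  show "x \<notin> {1..n} \<Longrightarrow> partition_perm P x = x" for x
    unfolding partition_onD1[OF P] partition_perm_def by (simp only: if_False)
qed

private lemma nth_block:
  assumes B: "B \<in> P" and i: "i < card B"
  shows "(partition_perm P ^^ i) (Min B) = sorted_list_of_set B ! i"
    and "partition_perm P (sorted_list_of_set B ! i) = sorted_list_of_set B ! (Suc i mod card B)"
proof -
  let ?xs = "sorted_list_of_set B"
  have xs: "distinct ?xs" "set ?xs = B" "length ?xs = card B" using block(3)[OF B] by simp_all
  have step: "partition_perm P (?xs ! i) = ?xs ! (Suc i mod card B)" if "i < card B" for i
  proof -
    have "?xs ! i \<in> B" using nth_mem[of i ?xs] xs that by simp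
    \<comment> \<open>The exponent 1 brings the step into the form of
      \<open>cyclic_rotation\<close>, by which a cycle acts on its own list as a rotation.\<close>
    then have "partition_perm P (?xs ! i) = map (cycle_of_list ?xs ^^ 1) ?xs ! i"
      using partition_perm_apply[OF P B] xs that by simp
    also have "\<dots> = rotate 1 ?xs ! i" by (simp only: cyclic_rotation[OF xs(1)])
    also have "\<dots> = ?xs ! (Suc i mod card B)" using nth_rotate[of i ?xs 1] xs that by simp
    finally show ?thesis .
  qed
  show "partition_perm P (?xs ! i) = ?xs ! (Suc i mod card B)" using i by (rule step)
  show "(partition_perm P ^^ i) (Min B) = ?xs ! i"
    using i
  proof (induction i)
    case 0
    then have "?xs \<noteq> []" using xs by force
    then have "?xs ! 0 = hd ?xs" by (simp add: hd_conv_nth)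
    then show ?case using block(2,3)[OF B] by (simp add: sorted_list_of_set_nonempty)
  next
    case (Suc i)
    then show ?case using step[of i] by simp
  qed
qed

lemma orbit_partition_perm:
  assumes B: "B \<in> P" "x \<in> B"
  shows "orbit (partition_perm P) x = B"
proof -
  let ?xs = "sorted_list_of_set B"
  have perm: "permutation (partition_perm P)"
    using partition_perm_permutes by (rule permutes_permutation)
  have xs: "set ?xs = B" "length ?xs = card B" using block(3)[OF B(1)] by simp_all
  have closed: "partition_perm P y \<in> B" if "y \<in> B" for y
    using image_block[OF B(1)] that by blast
  have MinB: "Min B \<in> B" using block(2,3)[OF B(1)] by simp
  have "y \<in> B" if "y \<in> orbit (partition_perm P) (Min B)" for y
    using that by (induction rule: orbit.induct) (simp_all add: closed MinB)
  moreover have "y \<in> orbit (partition_perm P) (Min B)" if "y \<in> B" for y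
  proof -
    have "y \<in> set ?xs" unfolding xs(1) by (rule that)
    then obtain i where "i < card B" "y = ?xs ! i" unfolding in_set_conv_nth xs(2) by blast
    then have "y = (partition_perm P ^^ i) (Min B)" using nth_block(1)[OF B(1)] by simp
    then show ?thesis using orbit_altdef_permutation[OF perm] by auto
  qed
  ultimately have "orbit (partition_perm P) (Min B) = B" by blast
  then show ?thesis using iffD2[OF orbit_eq_iff[OF perm, of x "Min B"]] B(2) by blast
qed

lemma orbits_partition_perm: "orbit (partition_perm P) ` {1..n} = P"
proof (intro equalityI subsetI)
  fix C assume "C \<in> orbit (partition_perm P) ` {1..n}"
  then obtain x where x: "x \<in> {1..n}" "C = orbit (partition_perm P) x" by blast
  then obtain B where "B \<in> P" "x \<in> B" unfolding partition_onD1[OF P] by blast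
  then show "C \<in> P" using orbit_partition_perm x(2) by simp
next
  fix B assume B: "B \<in> P"
  then obtain x where "x \<in> B" using block(2) by auto
  then show "B \<in> orbit (partition_perm P) ` {1..n}"
    using block(1)[OF B] orbit_partition_perm[OF B] by blast
qed

text \<open>Along a block in increasing order only the last entry does not map to a larger one, and
  it maps to the minimum.\<close>

lemma back_points_partition_perm: "back_points n (partition_perm P) = {}"
proof (rule ccontr)
  assume "back_points n (partition_perm P) \<noteq> {}"
  then obtain x where x: "x \<in> {1..n}" "partition_perm P x < x"
    "partition_perm P x \<noteq> Min (orbit (partition_perm P) x)" by (auto simp: back_points_def)
  obtain B where B: "B \<in> P" "x \<in> B" using x(1) unfolding partition_onD1[OF P] by blast
  let ?xs = "sorted_list_of_set B"
  have xs: "set ?xs = B" "length ?xs = card B" "sorted ?xs" using block(3)[OF B(1)] by simp_all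
  have "x \<in> set ?xs" unfolding xs(1) by (rule B(2))
  then obtain i where i: "i < card B" "x = ?xs ! i" unfolding in_set_conv_nth xs(2) by blast
  have next_x: "partition_perm P x = ?xs ! (Suc i mod card B)" using nth_block(2)[OF B(1) i(1)] i(2) by simp
  show False
  proof (cases "Suc i < card B")
    case True
    then show False using x(2) next_x i xs sorted_nth_mono[of ?xs i "Suc i"] by simp
  next
    case False
    then have "Suc i = card B" using i by simp
    then have "partition_perm P x = ?xs ! 0" using next_x by simp
    also have "\<dots> = Min B" using nth_block(1)[OF B(1), of 0] i(1) by simp
    finally show False using x(3) orbit_partition_perm[OF B] by simp
  qed
qed

end

lemma p_back_0_partitions: "p_back 0 n k = card (genus1_partitions n k)"
proof -
  let ?A = "{\<alpha> \<in> genus1_perms n k. card (back_points n \<alpha>) = 0}"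
  have fin: "finite (back_points n \<alpha>)" for \<alpha> by (simp add: back_points_def)
  have "bij_betw partition_perm (genus1_partitions n k) ?A"
  proof (rule bij_betw_byWitness[where f' = "\<lambda>\<alpha>. orbit \<alpha> ` {1..n}"])
    show "\<forall>P\<in>genus1_partitions n k. orbit (partition_perm P) ` {1..n} = P"
      using orbits_partition_perm by (simp add: genus1_partitions_def)
    show "\<forall>\<alpha>\<in>?A. partition_perm (orbit \<alpha> ` {1..n}) = \<alpha>"
      using partition_perm_orbits fin by (simp add: genus1_perms_def)
    show "partition_perm ` genus1_partitions n k \<subseteq> ?A"
      using partition_perm_permutes orbits_partition_perm back_points_partition_perm
      by (auto simp: genus1_partitions_def genus1_perms_def num_cycles_def)
    show "(\<lambda>\<alpha>. orbit \<alpha> ` {1..n}) ` ?A \<subseteq> genus1_partitions n k"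
      using partition_on_orbits partition_perm_orbits fin
      by (auto simp: genus1_partitions_def genus1_perms_def num_cycles_def)
  qed
  then show ?thesis unfolding p_back_def by (rule bij_betw_same_card[symmetric])
qed

theorem theorem7p2:
  fixes n k :: nat
  assumes "n \<ge> 1" and "k \<ge> 1"
  shows "real (p_star n k) =
           1/6 * ibinom (int n + 1) 2 * ibinom (int n - 1) (int k + 1) * ibinom (int n - 1) (int k - 1)
       \<and> real (p_back 0 n k) =
           1/6 * ibinom (int n) 2 * ibinom (int n - 2) (int k) * ibinom (int n - 2) (int k - 2)
       \<and> real (p_back 2 n k) =
           1/6 * ibinom (int n) 2 * ibinom (int n - 2) (int k + 1) * ibinom (int n - 2) (int k - 1)
       \<and> real (p_back 1 n k) =
           1/3 * ibinom (int n) 2 * ibinom (int n - 2) (int k) * ibinom (int n - 2) (int k - 1)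
       \<and> p_back 0 n k = card (genus1_partitions n k)"
  using card_genus1[OF assms] no_back_count_eq[OF assms] p_back_2_eq[OF assms] p_back_1_eq[OF assms]
  by (simp add: p_star_def p_back_0 p_back_0_partitions[symmetric])

end
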